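(* Let $f\in L^\infty(0,1)$ be such that the left and right approximate limits $$f^-(x):=\lim_{y\to x^-}\frac{1}{x-y}\int_y^x f(t)\,dt\quad\text{and}\quad f^+(x):=\lim_{y\to x^+}\frac{1}{y-x}\int_x^y f(t)\,dt$$ exist at every point $x\in(0,1)$. Let $\alpha_1,\alpha_2\in(0,+\infty)$, and let $u_{\alpha_1},u_{\alpha_2}\in BV(0,1)$ be the corresponding solutions of the ROF problem, that is, $u_{\alpha_i}$ is the unique minimizer over $u\in BV(0,1)$ of $$\mathcal I_{\alpha_i}[u]:=\frac12\|u-f\|_{L^2(0,1)}^2+\alpha_i\,TV(u,(0,1)).$$ If $\alpha_1\le\alpha_2$, then $$J_{u_{\alpha_2}}\subseteq J_{u_{\alpha_1}}\subseteq J_f.$$ Moreover, for each $x\in J_{u_{\alpha_2}}$, $$|u_{\alpha_1}^\ell(x)-u_{\alpha_1}^r(x)|\ \ge\ |u_{\alpha_2}^\ell(x)-u_{\alpha_2}^r(x)|.$$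
   Context: $TV(u,(0,1)):=\sup\{\int_0^1 u\,\psi'\,dx:\psi\in C^1_c(0,1),\ |\psi|\le 1\}$, and $BV(0,1)$ is the set of $u\in L^1(0,1)$ with $TV(u,(0,1))<+\infty$; equivalently, the distributional derivative $Du$ is a finite signed Radon measure on $(0,1)$. For $f\in L^2(0,1)$ and $\alpha>0$ the functional $\mathcal I_\alpha$ has a unique minimizer in $BV(0,1)$. For a locally integrable function $v$ on $(0,1)$, the jump set $J_v$ is the set of $x\in(0,1)$ at which the limits $v^-(x):=\lim_{y\to x^-}\frac1{x-y}\int_y^x v(t)\,dt$ and $v^+(x):=\lim_{y\to x^+}\frac1{y-x}\int_x^y v(t)\,dt$ both exist but are different. For $u\in BV(0,1)$ the left-continuous and right-continuous representatives are $u^\ell(x):=u(0)+Du((0,x))$ and $u^r(x):=u(0)+Du((0,x])$ for $x\in(0,1)$, where $u(0)$ is the trace of $u$ at $0$ (so $\lim_{\delta\to0^+}\frac1\delta\int_0^\delta|u(t)-u(0)|\,dt=0$). *)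

theory Defs
  imports "HOL-Analysis.Analysis"
begin

text \<open>
  Functions on the interval (0,1) are represented by functions of type \<open>real \<Rightarrow> real\<close>;
  their values outside (0,1) never matter, except for the test functions in \<open>C1c\<close>, which
  are extended by zero.
\<close>

definition L1 :: "(real \<Rightarrow> real) set" where
  "L1 = {u. set_integrable lebesgue {0<..<1} u}"

definition Linf :: "(real \<Rightarrow> real) set" where
  "Linf = {f. f \<in> borel_measurable (lebesgue_on {0<..<1}) \<and>
              (\<exists>C. AE x in lebesgue_on {0<..<1}. \<bar>f x\<bar> \<le> C)}"

definition C1c :: "(real \<Rightarrow> real) set" where
  "C1c = {\<psi>. \<psi> C1_differentiable_on UNIV \<and> compact (closure {x. \<psi> x \<noteq> 0}) \<and>
              closure {x. \<psi> x \<noteq> 0} \<subseteq> {0<..<1}}"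

text \<open>Only meaningful for functions in \<open>L1\<close>.\<close>

definition TV :: "(real \<Rightarrow> real) \<Rightarrow> ereal" where
  "TV u = (SUP \<psi>\<in>{\<psi> \<in> C1c. \<forall>x. \<bar>\<psi> x\<bar> \<le> 1}.
             ereal (LINT x:{0<..<1}|lebesgue. u x * deriv \<psi> x))"

definition BV :: "(real \<Rightarrow> real) set" where
  "BV = {u \<in> L1. TV u < \<infinity>}"

text \<open>
  The squared L2 norm is taken as an extended nonnegative integral, so that no square
  integrability has to be presupposed.
\<close>

definition rof_functional :: "real \<Rightarrow> (real \<Rightarrow> real) \<Rightarrow> (real \<Rightarrow> real) \<Rightarrow> ereal" where
  "rof_functional \<alpha> f u =
     ereal (1/2) * enn2ereal (\<integral>\<^sup>+x\<in>{0<..<1}. ennreal ((u x - f x)\<^sup>2) \<partial>lebesgue) + ereal \<alpha> * TV u"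

text \<open>Minimizers are unique only up to equality almost everywhere on (0,1).\<close>

definition rof_solution :: "real \<Rightarrow> (real \<Rightarrow> real) \<Rightarrow> (real \<Rightarrow> real) \<Rightarrow> bool" where
  "rof_solution \<alpha> f u \<longleftrightarrow>
     u \<in> BV \<and> (\<forall>v\<in>BV. rof_functional \<alpha> f u \<le> rof_functional \<alpha> f v)"

definition left_approx_lim :: "(real \<Rightarrow> real) \<Rightarrow> real \<Rightarrow> real \<Rightarrow> bool" where
  "left_approx_lim v x l \<longleftrightarrow>
     ((\<lambda>y. 1 / (x - y) * (LINT t:{y..x}|lebesgue. v t)) \<longlongrightarrow> l) (at_left x)"

definition right_approx_lim :: "(real \<Rightarrow> real) \<Rightarrow> real \<Rightarrow> real \<Rightarrow> bool" where
  "right_approx_lim v x l \<longleftrightarrow>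
     ((\<lambda>y. 1 / (y - x) * (LINT t:{x..y}|lebesgue. v t)) \<longlongrightarrow> l) (at_right x)"

definition jump_set :: "(real \<Rightarrow> real) \<Rightarrow> real set" where
  "jump_set v = {x\<in>{0<..<1}. \<exists>l r. left_approx_lim v x l \<and> right_approx_lim v x r \<and> l \<noteq> r}"

text \<open>
  A finite signed Radon measure on (0,1) is represented as the difference of two finite Borel
  measures P and N on (0,1) (Jordan decomposition; P and N need not be mutually singular, and
  on (0,1) finite Borel measures are automatically Radon). As a set function it is determined
  by u alone. Its value is 0 on sets that are not Borel subsets of (0,1).
\<close>

definition is_distr_deriv :: "(real \<Rightarrow> real) \<Rightarrow> (real set \<Rightarrow> real) \<Rightarrow> bool" where
  "is_distr_deriv u \<mu> \<longleftrightarrow>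
     (\<exists>P N :: real measure. finite_measure P \<and> finite_measure N \<and>
        sets P = sets (restrict_space borel {0<..<1}) \<and>
        sets N = sets (restrict_space borel {0<..<1}) \<and>
        (\<forall>A. \<mu> A = measure P A - measure N A) \<and>
        (\<forall>\<psi>\<in>C1c. (LINT x:{0<..<1}|lebesgue. u x * deriv \<psi> x) =
                  - ((LINT x|P. \<psi> x) - (LINT x|N. \<psi> x))))"

definition distr_deriv :: "(real \<Rightarrow> real) \<Rightarrow> real set \<Rightarrow> real" where
  "distr_deriv u = (THE \<mu>. is_distr_deriv u \<mu>)"

definition trace0 :: "(real \<Rightarrow> real) \<Rightarrow> real" where
  "trace0 u = (THE c. ((\<lambda>\<delta>. 1 / \<delta> * (LINT t:{0<..<\<delta>}|lebesgue. \<bar>u t - c\<bar>)) \<longlongrightarrow> 0) (at_right 0))"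

definition left_rep :: "(real \<Rightarrow> real) \<Rightarrow> real \<Rightarrow> real" where
  "left_rep u x = trace0 u + distr_deriv u {0<..<x}"

definition right_rep :: "(real \<Rightarrow> real) \<Rightarrow> real \<Rightarrow> real" where
  "right_rep u x = trace0 u + distr_deriv u {0<..x}"

end

theory Submission
  imports Defs
begin

text \<open>
  In one dimension the ROF minimizer is the derivative of a taut string, and the theorem is a
  comparison between two strings in tubes of different radius around the same curve.

  Let \<open>F\<close> and \<open>U\<close> be the primitives of \<open>f\<close> and of a minimizer \<open>u\<close>. Then \<open>\<bar>F - U\<bar> \<le> \<alpha>\<close>, the end points of
  \<open>F\<close> and \<open>U\<close> agree, and \<open>U\<close> is convex wherever \<open>F - U < \<alpha>\<close> and concave wherever \<open>F - U > - \<alpha>\<close>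
  (\<open>rof_solution_taut_string\<close>). This follows from minimality by convex duality:
  \<open>(F - U) / \<alpha>\<close> is a field with values in \<open>[-1, 1]\<close> that attains the supremum defining \<open>TV u\<close>, and
  perturbing it by tents gives the convexity. The perturbed field is only absolutely
  continuous, so the duality inequality has to be extended to fields whose derivative is merely
  integrable, together with its product with \<open>u\<close> (\<open>dual_bound_absolutely_integrable\<close>).

  The approximate limits of \<open>u\<close> are the one-sided derivatives of \<open>U\<close>. If the slope of \<open>U\<close> jumps upwards
  at \<open>x\<close>, then \<open>U\<close> is not concave there, so \<open>F - U\<close> has the value \<open>- \<alpha>\<close> at \<open>x\<close>, which is its minimum.
  Comparing one-sided derivatives at this minimum shows that \<open>f\<close> jumps at \<open>x\<close> as well. For two radii
  \<open>\<alpha>1 \<le> \<alpha>2\<close>, a maximum principle gives \<open>U2 - U1 \<le> \<alpha>2 - \<alpha>1\<close> (\<open>taut_string_comparison\<close>), and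
  where the slope of \<open>U2\<close> jumps upwards this bound is attained. So \<open>U2 - U1\<close> has a maximum there, and
  comparing one-sided derivatives shows that the jump of \<open>u1\<close> contains the jump of \<open>u2\<close>. Downward
  jumps follow by reflection.

  It remains to see that the one-sided derivatives exist and that their difference is the jump of the
  representatives of \<open>u\<close>. Every point has a neighbourhood on which \<open>U\<close> is convex or concave, so by
  compactness the derivative of \<open>U\<close> is a difference of two right-continuous monotone functions
  (\<open>taut_string_BV_primitive\<close>). The difference of their Stieltjes measures is the
  distributional derivative of \<open>u\<close> (\<open>distr_deriv_eq\<close>), and its atom at \<open>x\<close> is the jump.
\<close>

section \<open>Testing the total variation with absolutely continuous fields\<close>

lemma absolutely_integrable_times_continuous:
  fixes u h :: "real \<Rightarrow> real"
  assumes "u absolutely_integrable_on {a..b}" "continuous_on {a..b} h"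
  shows "(\<lambda>x. u x * h x) absolutely_integrable_on {a..b}"
proof -
  have "(\<lambda>x. h x * u x) absolutely_integrable_on {a..b}"
    using assms
    by (intro absolutely_integrable_bounded_measurable_product_real)
       (auto intro!: compact_imp_bounded compact_continuous_image
          continuous_imp_measurable_on_sets_lebesgue)
  then show ?thesis by (simp add: mult.commute)
qed

text \<open>
  Continuous approximations of a measurable function converge only off a null set, while the
  primitives below call for the gauge integral; hence this variant of dominated convergence.
\<close>
lemma dominated_convergence_ae:
  fixes f :: "nat \<Rightarrow> real \<Rightarrow> real"
  assumes N: "negligible N" and f: "\<And>k. f k integrable_on S" and h: "h integrable_on S"
    and le: "\<And>k x. x \<in> S \<Longrightarrow> \<bar>f k x\<bar> \<le> h x"
    and conv: "\<And>x. x \<in> S - N \<Longrightarrow> (\<lambda>k. f k x) \<longlonglongrightarrow> g x"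
  shows "g integrable_on S" "(\<lambda>k. integral S (f k)) \<longlonglongrightarrow> integral S g"
proof -
  define f' where "f' = (\<lambda>k x. if x \<in> N then 0 else f k x)"
  define g' where "g' = (\<lambda>x. if x \<in> N then 0 else g x)"
  have 1: "f' k integrable_on S" for k
    by (rule integrable_spike[OF f N]) (auto simp: f'_def)
  have le': "norm (f' k x) \<le> h x" if "x \<in> S" for k x
    using le[OF that, of k] by (auto simp: f'_def)
  have conv': "(\<lambda>k. f' k x) \<longlonglongrightarrow> g' x" if "x \<in> S" for x
    using conv that by (auto simp: f'_def g'_def)
  have a: "g' integrable_on S" "(\<lambda>k. integral S (f' k)) \<longlonglongrightarrow> integral S g'"
    using dominated_convergence[of f' S h g', OF 1 h le' conv'] by auto
  show "g integrable_on S"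
    by (rule integrable_spike[OF a(1) N]) (auto simp: g'_def)
  have "integral S (f' k) = integral S (f k)" for k
    by (rule integral_spike[OF N]) (auto simp: f'_def)
  moreover have "integral S g' = integral S g"
    by (rule integral_spike[OF N]) (auto simp: g'_def)
  ultimately show "(\<lambda>k. integral S (f k)) \<longlonglongrightarrow> integral S g"
    using a(2) by simp
qed

text \<open>
  Mean zero is what makes the primitive vanish again to the right of the support of \<open>h\<close>.
\<close>
lemma primitive_in_C1c:
  fixes h :: "real \<Rightarrow> real"
  assumes cont: "continuous_on UNIV h" and d: "0 < \<delta>"
    and supp: "\<And>x. x \<notin> {\<delta>..1-\<delta>} \<Longrightarrow> h x = 0" and mean: "integral {0..1} h = 0"
  defines "\<psi> \<equiv> \<lambda>x. integral {0..x} h"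
  shows "\<psi> \<in> C1c" "deriv \<psi> = h"
proof -
  have left: "\<psi> x = 0" if "x < \<delta>" for x
  proof -
    have "integral {0..x} h = integral {0..x} (\<lambda>x. 0)"
      by (rule integral_cong) (use that supp in auto)
    then show ?thesis by (simp add: \<psi>_def)
  qed
  have int: "h integrable_on {a..b}" for a b
    by (rule integrable_continuous_real) (rule continuous_on_subset[OF cont], simp)
  have right: "\<psi> x = 0" if x: "x > 1 - \<delta>" for x
  proof -
    have z: "integral {a..b} h = 0" if "1 - \<delta> < a" for a b
    proof -
      have "integral {a..b} h = integral {a..b} (\<lambda>x. 0)"
        by (rule integral_cong) (use that supp in auto)
      then show ?thesis by simp
    qed
    show ?thesis
    proof (cases "x \<le> 1")
      case True
      show ?thesis
      proof (cases "x < 0")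
        case True
        then show ?thesis by (simp add: \<psi>_def)
      next
        case False
        then show ?thesis using Henstock_Kurzweil_Integration.integral_combine[of 0 x 1 h, OF _ _ int] True z[of x 1] x mean
          by (simp add: \<psi>_def)
      qed
    next
      case False
      then show ?thesis using Henstock_Kurzweil_Integration.integral_combine[of 0 1 x h, OF _ _ int] z[of 1 x] d mean
        by (simp add: \<psi>_def)
    qed
  qed
  have der: "(\<psi> has_real_derivative h x) (at x)" for x
  proof -
    consider "x < \<delta>" | "x > 1 - \<delta>" | "\<delta> \<le> x" "x \<le> 1 - \<delta>" by linarith
    then show ?thesis
    proof cases
      case 1
      have "((\<lambda>x. 0) has_real_derivative h x) (at x)" using supp[of x] 1 by simp
      then show ?thesis
        by (rule has_field_derivative_transform_within_open[of _ _ _ "{..<\<delta>}"]) (use 1 left in auto)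
    next
      case 2
      have "((\<lambda>x. 0) has_real_derivative h x) (at x)" using supp[of x] 2 by simp
      then show ?thesis
        by (rule has_field_derivative_transform_within_open[of _ _ _ "{1-\<delta><..}"]) (use 2 right in auto)
    next
      case 3
      have "(\<psi> has_real_derivative h x) (at x within {0..1})" unfolding \<psi>_def
        by (rule integral_has_real_derivative) (use 3 d cont in \<open>auto intro: continuous_on_subset\<close>)
      moreover have "at x within {0..1} = at x"
        by (rule at_within_interior) (use 3 d in auto)
      ultimately show ?thesis by simp
    qed
  qed
  show "deriv \<psi> = h" using der by (auto intro!: DERIV_imp_deriv)
  have "closure {x. \<psi> x \<noteq> 0} \<subseteq> {\<delta>..1-\<delta>}"
    by (rule closure_minimal) (use left right in \<open>auto simp: not_less[symmetric]\<close>)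
  moreover from this have "compact (closure {x. \<psi> x \<noteq> 0})"
    by (meson bounded_closed_interval bounded_subset closed_closure compact_eq_bounded_closed)
  ultimately show "\<psi> \<in> C1c"
    using der cont d unfolding C1c_def C1_differentiable_on_def
    by (force simp: has_real_derivative_iff_has_vector_derivative)
qed

text \<open>
  The bound \<open>TV u \<le> T\<close> with a real \<open>T\<close>, expressed by gauge integrals so that it combines directly
  with the fundamental theorem of calculus; \<open>TV_le_iff\<close> gives the equivalence.
\<close>
definition TV_le :: "(real \<Rightarrow> real) \<Rightarrow> real \<Rightarrow> bool" where
  "TV_le u T \<longleftrightarrow> (\<forall>\<psi>\<in>C1c. (\<forall>x. \<bar>\<psi> x\<bar> \<le> 1) \<longrightarrow> integral {0..1} (\<lambda>x. u x * deriv \<psi> x) \<le> T)"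

text \<open>
  The duality inequality \<open>\<integral> u \<phi>' \<le> sup \<bar>\<phi>\<bar> * TV u\<close> for the field \<open>\<phi>\<close> with \<open>\<phi>(0) = 0\<close> and \<open>\<phi>' = h\<close>,
  with \<open>T\<close> in the place of \<open>TV u\<close>.
  Keeping the bound \<open>M\<close> for \<open>\<bar>\<phi>\<bar>\<close> variable makes the inequality stable under limits: an
  approximating field may exceed \<open>M\<close> by an error that tends to zero.
\<close>
definition dual_bound :: "(real \<Rightarrow> real) \<Rightarrow> real \<Rightarrow> (real \<Rightarrow> real) \<Rightarrow> bool" where
  "dual_bound u T h \<longleftrightarrow>
     (\<forall>M>0. (\<forall>x\<in>{0..1}. \<bar>integral {0..x} h\<bar> \<le> M) \<longrightarrow> integral {0..1} (\<lambda>x. u x * h x) \<le> M * T)"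

lemma dual_bound_test_function:
  assumes "TV_le u T" and cont: "continuous_on UNIV h" and d: "0 < \<delta>"
    and supp: "\<And>x. x \<notin> {\<delta>..1-\<delta>} \<Longrightarrow> h x = 0" and mean: "integral {0..1} h = 0"
  shows "dual_bound u T h"
  unfolding dual_bound_def
proof (intro allI impI)
  fix M :: real assume M: "0 < M" and b: "\<forall>x\<in>{0..1}. \<bar>integral {0..x} h\<bar> \<le> M"
  define \<psi> where "\<psi> = (\<lambda>x. integral {0..x} (\<lambda>x. h x / M))"
  have p: "\<psi> \<in> C1c" "deriv \<psi> = (\<lambda>x. h x / M)" unfolding \<psi>_def
    using primitive_in_C1c[of "\<lambda>x. h x / M" \<delta>, OF continuous_on_divide[OF cont continuous_on_const] d] supp mean M
    by auto
  have "\<bar>\<psi> x\<bar> \<le> 1" for x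
  proof (cases "x \<in> {0..1}")
    case True
    then show ?thesis using b M by (auto simp: \<psi>_def)
  next
    case False
    show ?thesis
    proof (rule ccontr)
      assume "\<not> \<bar>\<psi> x\<bar> \<le> 1"
      then have "x \<in> closure {x. \<psi> x \<noteq> 0}" by (intro subsetD[OF closure_subset]) auto
      then show False using p(1) False unfolding C1c_def by auto
    qed
  qed
  then have "integral {0..1} (\<lambda>x. u x * deriv \<psi> x) \<le> T"
    using assms(1) p(1) unfolding TV_le_def by blast
  then show "integral {0..1} (\<lambda>x. u x * h x) \<le> M * T"
    using M unfolding p(2) by (simp add: field_simps)
qed

text \<open>
  Convergence \<open>k n \<longlonglongrightarrow> h\<close> in the mean makes the primitives converge uniformly, so the duality
  inequality passes to the limit. The multiple of \<open>\<eta>\<close> restores mean zero, which truncation and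
  cut-off destroy; the required multiple tends to zero because \<open>h\<close> itself has mean zero.
\<close>
lemma dual_bound_limit:
  fixes u h w \<eta> :: "real \<Rightarrow> real" and k :: "nat \<Rightarrow> real \<Rightarrow> real"
  assumes u: "u absolutely_integrable_on {0..1}" and N: "negligible N"
    and k: "\<And>n. k n absolutely_integrable_on {0..1}"
    and uk: "\<And>n. (\<lambda>x. u x * k n x) absolutely_integrable_on {0..1}"
    and w: "w absolutely_integrable_on {0..1}" and uw: "(\<lambda>x. u x * w x) absolutely_integrable_on {0..1}"
    and le: "\<And>n x. x \<in> {0..1} \<Longrightarrow> \<bar>k n x\<bar> \<le> w x"
    and conv: "\<And>x. x \<in> {0..1} - N \<Longrightarrow> (\<lambda>n. k n x) \<longlonglongrightarrow> h x"
    and mean: "integral {0..1} h = 0"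
    and eta: "continuous_on {0..1} \<eta>"
    and db: "\<And>n. dual_bound u T (\<lambda>x. k n x - integral {0..1} (k n) * \<eta> x)"
  shows "dual_bound u T h"
proof -
  have int: "f integrable_on {0..1}" if "f absolutely_integrable_on {0..1}" for f :: "real \<Rightarrow> real"
    using that by (rule set_lebesgue_integral_eq_integral(1))
  define c where "c = (\<lambda>n. integral {0..1} (k n))"
  note dc = dominated_convergence_ae[OF N int[OF k] int[OF w] le conv, simplified]
  have h: "h integrable_on {0..1}" by (rule dc(1))
  have c: "c \<longlonglongrightarrow> 0" using dc(2) mean by (simp add: c_def)
  define g where "g = (\<lambda>n x. k n x - c n * \<eta> x)"
  have eta_i: "\<eta> absolutely_integrable_on {0..1}"
    using absolutely_integrable_continuous_real eta by blast
  have g_abs: "g n absolutely_integrable_on {0..1}" for n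
    unfolding g_def by (intro set_integral_diff(1) k set_integrable_mult_right eta_i)
  have ueta: "(\<lambda>x. u x * \<eta> x) absolutely_integrable_on {0..1}"
    by (rule absolutely_integrable_times_continuous[OF u eta])
  have Bc: "Bseq c" using c by (intro convergent_imp_Bseq convergentI)
  then obtain C where C: "0 < C" "\<And>n. \<bar>c n\<bar> \<le> C" by (auto simp: Bseq_def)
  have gle: "\<bar>g n x\<bar> \<le> w x + C * \<bar>\<eta> x\<bar>" if "x \<in> {0..1}" for n x
  proof -
    have "\<bar>g n x\<bar> \<le> \<bar>k n x\<bar> + \<bar>c n\<bar> * \<bar>\<eta> x\<bar>" unfolding g_def
      by (metis abs_mult abs_triangle_ineq4)
    also have "\<dots> \<le> w x + C * \<bar>\<eta> x\<bar>" using le[OF that, of n] C(2)[of n]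
      by (intro add_mono mult_right_mono) auto
    finally show ?thesis .
  qed
  have gconv: "(\<lambda>n. g n x) \<longlonglongrightarrow> h x" if "x \<in> {0..1} - N" for x
  proof -
    have "(\<lambda>n. k n x - c n * \<eta> x) \<longlonglongrightarrow> h x - 0 * \<eta> x"
      by (intro tendsto_intros conv[OF that] c)
    then show ?thesis by (simp add: g_def)
  qed
  have dom: "(\<lambda>x. w x + C * \<bar>\<eta> x\<bar>) integrable_on {0..1}"
    by (intro integrable_add int w integrable_on_mult_right)
       (use set_integrable_abs[OF eta_i] in auto)
  define e where "e = (\<lambda>n. integral {0..1} (\<lambda>x. \<bar>g n x - h x\<bar>))"
  have h_abs: "h absolutely_integrable_on {0..1}"
  proof (rule measurable_bounded_by_integrable_imp_absolutely_integrable)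
    show "h \<in> borel_measurable (lebesgue_on {0..1})" using h by (rule integrable_imp_measurable)
    show "(\<lambda>x. max (w x) \<bar>h x\<bar>) integrable_on {0..1}"
    proof (rule integrable_spike[OF int[OF w] N])
      fix x assume x: "x \<in> {0..1} - N"
      have "\<bar>h x\<bar> \<le> w x"
        by (rule tendsto_upperbound[OF tendsto_rabs[OF conv[OF x]]]) (use le x in auto)
      then show "max (w x) \<bar>h x\<bar> = w x" by simp
    qed
  qed auto
  have e: "e \<longlonglongrightarrow> 0"
  proof -
    have "(\<lambda>n. integral {0..1} (\<lambda>x. \<bar>g n x - h x\<bar>)) \<longlonglongrightarrow> integral {0..1} (\<lambda>x::real. 0::real)"
    proof (rule dominated_convergence_ae(2)[OF N])
      show "(\<lambda>x. \<bar>g n x - h x\<bar>) integrable_on {0..1}" for n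
        by (intro int set_integrable_abs set_integral_diff(1) g_abs h_abs)
      show "(\<lambda>x. (w x + C * \<bar>\<eta> x\<bar>) + \<bar>h x\<bar>) integrable_on {0..1}"
        by (intro integrable_add dom int set_integrable_abs h_abs)
      show "\<bar>\<bar>g n x - h x\<bar>\<bar> \<le> (w x + C * \<bar>\<eta> x\<bar>) + \<bar>h x\<bar>" if "x \<in> {0..1}" for n x
        using gle[OF that, of n] by linarith
      show "(\<lambda>n. \<bar>g n x - h x\<bar>) \<longlonglongrightarrow> 0" if "x \<in> {0..1} - N" for x
        using tendsto_rabs[OF tendsto_diff[OF gconv[OF that] tendsto_const[of "h x"]]] by simp
    qed
    then show ?thesis by (simp add: e_def)
  qed
  have ug: "(\<lambda>x. u x * g n x) absolutely_integrable_on {0..1}" for n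
  proof -
    have "(\<lambda>x. u x * k n x - c n * (u x * \<eta> x)) absolutely_integrable_on {0..1}"
      by (intro set_integral_diff(1) uk set_integrable_mult_right ueta)
    then show ?thesis by (simp add: g_def algebra_simps)
  qed
  have ulim: "(\<lambda>n. integral {0..1} (\<lambda>x. u x * g n x)) \<longlonglongrightarrow> integral {0..1} (\<lambda>x. u x * h x)"
  proof (rule dominated_convergence_ae(2)[OF N])
    show "(\<lambda>x. u x * g n x) integrable_on {0..1}" for n by (intro int ug)
    show "(\<lambda>x. \<bar>u x * w x\<bar> + C * \<bar>u x * \<eta> x\<bar>) integrable_on {0..1}"
      by (intro int set_integral_add(1) set_integrable_abs set_integrable_mult_right uw ueta)
    show "\<bar>u x * g n x\<bar> \<le> \<bar>u x * w x\<bar> + C * \<bar>u x * \<eta> x\<bar>" if "x \<in> {0..1}" for n x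
    proof -
      have "\<bar>u x * g n x\<bar> \<le> \<bar>u x\<bar> * (w x + C * \<bar>\<eta> x\<bar>)"
        unfolding abs_mult by (intro mult_left_mono gle that) auto
      also have "\<dots> \<le> \<bar>u x * w x\<bar> + C * \<bar>u x * \<eta> x\<bar>"
        using mult_left_mono[OF abs_ge_self[of "w x"], of "\<bar>u x\<bar>"] by (simp add: algebra_simps abs_mult)
      finally show ?thesis .
    qed
    show "(\<lambda>n. u x * g n x) \<longlonglongrightarrow> u x * h x" if "x \<in> {0..1} - N" for x
      by (intro tendsto_intros gconv that)
  qed
  show ?thesis unfolding dual_bound_def
  proof (intro allI impI)
    fix M :: real assume M: "0 < M" and b: "\<forall>x\<in>{0..1}. \<bar>integral {0..x} h\<bar> \<le> M"
    have "integral {0..1} (\<lambda>x. u x * g n x) \<le> (M + e n) * T" for n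
    proof -
      have "\<bar>integral {0..x} (g n)\<bar> \<le> M + e n" if x: "x \<in> {0..1}" for x
      proof -
        have sub: "{0..x} \<subseteq> {0..1}" using x by auto
        have i1: "g n integrable_on {0..x}" using integrable_on_subinterval[OF int[OF g_abs] sub] .
        have i2: "h integrable_on {0..x}" using integrable_on_subinterval[OF h sub] .
        have ia: "(\<lambda>x. \<bar>g n x - h x\<bar>) integrable_on {0..1}"
          by (intro int set_integrable_abs set_integral_diff(1) g_abs h_abs)
        have ia': "(\<lambda>x. \<bar>g n x - h x\<bar>) integrable_on {0..x}" using integrable_on_subinterval[OF ia sub] .
        have "\<bar>integral {0..x} (\<lambda>x. g n x - h x)\<bar> \<le> integral {0..x} (\<lambda>x. \<bar>g n x - h x\<bar>)"
          using integral_norm_bound_integral[OF integrable_diff[OF i1 i2] ia'] by simp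
        also have "\<dots> \<le> e n" unfolding e_def
          by (rule integral_subset_le[OF sub ia' ia]) auto
        finally have "\<bar>integral {0..x} (g n) - integral {0..x} h\<bar> \<le> e n"
          by (simp add: Henstock_Kurzweil_Integration.integral_diff[OF i1 i2])
        then show ?thesis using b x by fastforce
      qed
      moreover have "0 \<le> e n" unfolding e_def
        by (rule Henstock_Kurzweil_Integration.integral_nonneg)
           (auto intro!: int set_integrable_abs set_integral_diff(1) g_abs h_abs)
      ultimately show ?thesis using db[of n] M
        unfolding dual_bound_def g_def c_def by fastforce
    qed
    then have "integral {0..1} (\<lambda>x. u x * h x) \<le> (M + 0) * T"
      by (intro LIMSEQ_le[OF ulim tendsto_mult[OF tendsto_add[OF tendsto_const e] tendsto_const]]) auto
    then show "integral {0..1} (\<lambda>x. u x * h x) \<le> M * T" by simp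
  qed
qed

lemma bump_exists:
  obtains \<eta> :: "real \<Rightarrow> real" where "continuous_on UNIV \<eta>" "\<And>x. x \<notin> {1/4..3/4} \<Longrightarrow> \<eta> x = 0"
    "integral {0..1} \<eta> = 1"
proof -
  define b :: "real \<Rightarrow> real" where "b = (\<lambda>x. max 0 (1/4 - \<bar>x - 1/2\<bar>))"
  have cont: "continuous_on S b" for S unfolding b_def by (intro continuous_intros)
  have int: "b integrable_on {x..y}" for x y by (intro integrable_continuous_real cont)
  have "0 < integral {3/8..5/8::real} (\<lambda>x. 1/8::real)" by simp
  also have "\<dots> \<le> integral {3/8..5/8} b"
  proof (rule integral_le)
    show "1/8 \<le> b x" if "x \<in> {3/8..5/8}" for x
      using that by (simp add: b_def max_def abs_if)
  qed (auto simp: int)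
  also have "\<dots> \<le> integral {0..1} b"
    by (rule integral_subset_le) (auto simp: int, auto simp: b_def)
  finally have "0 < integral {0..1} b" .
  then show ?thesis
    by (intro that[of "\<lambda>x. b x / integral {0..1} b"])
       (auto intro!: continuous_intros cont simp: b_def)
qed

text \<open>
  A bounded measurable function is an almost everywhere limit of continuous functions. Clamping
  these to the bound of \<open>h\<close> gives domination, and a cut-off near \<open>0\<close> and \<open>1\<close> gives compact support, so
  that the corrected approximations are derivatives of test functions.
\<close>
lemma dual_bound_bounded:
  fixes u h :: "real \<Rightarrow> real"
  assumes T: "TV_le u T" and u: "u absolutely_integrable_on {0..1}"
    and h: "h \<in> borel_measurable (lebesgue_on {0..1})" and K: "\<And>x. x \<in> {0..1} \<Longrightarrow> \<bar>h x\<bar> \<le> K"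
    and mean: "integral {0..1} h = 0"
  shows "dual_bound u T h"
proof -
  obtain \<eta> :: "real \<Rightarrow> real" where eta: "continuous_on UNIV \<eta>" "\<And>x. x \<notin> {1/4..3/4} \<Longrightarrow> \<eta> x = 0"
    "integral {0..1} \<eta> = 1" using bump_exists by metis
  have "h measurable_on {0..1}" using h by (simp add: measurable_on_iff_borel_measurable)
  then obtain N g where N: "negligible N" and g: "\<And>n. continuous_on UNIV (g n)"
    and gh: "\<And>x. x \<notin> N \<Longrightarrow> (\<lambda>n. g n x) \<longlonglongrightarrow> (if x \<in> {0..1} then h x else 0)"
    unfolding measurable_on_def by blast
  have K0: "0 \<le> K" using K[of 0] by auto
  \<comment> \<open>The offset 4 keeps the interval where the cut-off is nonzero wide enough to contain
    the support of \<open>\<eta>\<close>.\<close>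
  define cut :: "nat \<Rightarrow> real \<Rightarrow> real" where "cut = (\<lambda>n x. max 0 (min 1 (real (n + 4) * min x (1 - x) - 1)))"
  define k where "k = (\<lambda>n x. max (-K) (min K (g n x)) * cut n x)"
  have kc: "continuous_on S (k n)" for n S
    unfolding k_def cut_def by (intro continuous_intros continuous_on_subset[OF g]) auto
  have cut01: "0 \<le> cut n x" "cut n x \<le> 1" for n x by (auto simp: cut_def)
  have kle: "\<bar>k n x\<bar> \<le> K" for n x
  proof -
    have "\<bar>k n x\<bar> \<le> K * 1" unfolding k_def abs_mult
      by (rule mult_mono) (use K0 cut01[of n x] in auto)
    then show ?thesis by simp
  qed
  have cutlim: "(\<lambda>n. cut n x) \<longlonglongrightarrow> 1" if x: "x \<in> {0<..<1}" for x
  proof -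
    have m: "0 < min x (1 - x)" using x by auto
    obtain n0 where n0: "2 / min x (1 - x) < real n0" using reals_Archimedean2 by blast
    have "cut n x = 1" if "n \<ge> n0" for n
    proof -
      have "2 / min x (1 - x) < real (n + 4)" using n0 that by simp
      then have "2 < real (n + 4) * min x (1 - x)" using m by (simp add: pos_divide_less_eq)
      then show ?thesis unfolding cut_def by simp
    qed
    then show ?thesis by (intro tendsto_eventually) (auto simp: eventually_sequentially)
  qed
  have conv: "(\<lambda>n. k n x) \<longlonglongrightarrow> h x" if x: "x \<in> {0..1} - (N \<union> {0,1})" for x
  proof -
    have "(\<lambda>n. max (-K) (min K (g n x)) * cut n x) \<longlonglongrightarrow> max (-K) (min K (h x)) * 1"
      using gh[of x] x by (intro tendsto_intros cutlim) auto
    moreover have "max (-K) (min K (h x)) = h x" using K[of x] x by auto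
    ultimately show ?thesis by (simp add: k_def)
  qed
  have db: "dual_bound u T (\<lambda>x. k n x - integral {0..1} (k n) * \<eta> x)" for n
  proof (rule dual_bound_test_function[OF T, of _ "1 / real (n + 4)"])
    show "continuous_on UNIV (\<lambda>x. k n x - integral {0..1} (k n) * \<eta> x)"
      by (intro continuous_intros kc eta)
    show "0 < 1 / real (n + 4)" by simp
    fix x :: real assume x: "x \<notin> {1 / real (n + 4)..1 - 1 / real (n + 4)}"
    have "1 / real (n + 4) \<le> 1 / 4" by (simp add: field_simps)
    then have "x \<notin> {1/4..3/4}" using x unfolding atLeastAtMost_iff by linarith
    then have e0: "\<eta> x = 0" by (rule eta(2))
    have "min x (1 - x) \<le> 1 / real (n + 4)" using x by auto
    then have "real (n + 4) * min x (1 - x) \<le> 1" by (simp add: field_simps)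
    then have "cut n x = 0" unfolding cut_def by simp
    then show "k n x - integral {0..1} (k n) * \<eta> x = 0" using e0 by (simp add: k_def)
  next
    have "integral {0..1} (\<lambda>x. k n x - integral {0..1} (k n) * \<eta> x)
        = integral {0..1} (k n) - integral {0..1} (\<lambda>x. integral {0..1} (k n) * \<eta> x)"
      by (rule Henstock_Kurzweil_Integration.integral_diff)
         (auto intro!: integrable_continuous_real kc continuous_intros continuous_on_subset[OF eta(1)])
    then show "integral {0..1} (\<lambda>x. k n x - integral {0..1} (k n) * \<eta> x) = 0"
      using eta(3) by simp
  qed
  show ?thesis
  proof (rule dual_bound_limit[OF u, of "N \<union> {0,1}" k "\<lambda>x. K" h \<eta>])
    show "negligible (N \<union> {0,1})" using N by simp
    show "k n absolutely_integrable_on {0..1}" for n by (intro absolutely_integrable_continuous_real kc)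
    show "(\<lambda>x. u x * k n x) absolutely_integrable_on {0..1}" for n
      by (intro absolutely_integrable_times_continuous u kc)
    show "(\<lambda>x::real. K) absolutely_integrable_on {0..1}"
      by (rule absolutely_integrable_continuous_real[OF continuous_on_const])
    show "(\<lambda>x. u x * K) absolutely_integrable_on {0..1}" by (intro absolutely_integrable_times_continuous u) auto
    show "continuous_on {0..1} \<eta>" using eta(1) by (rule continuous_on_subset) auto
  qed (use kle conv mean db in auto)
qed

text \<open>
  Truncation at height \<open>n\<close> reduces to bounded functions; the truncations are dominated by \<open>\<bar>h\<bar>\<close>, and
  integrability of \<open>u * h\<close> dominates the pairing with \<open>u\<close>. This admits fields whose derivative
  involves \<open>u\<close> itself, as needed for the dual certificate of a minimizer.
\<close>
lemma dual_bound_absolutely_integrable: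
  fixes u h :: "real \<Rightarrow> real"
  assumes T: "TV_le u T" and u: "u absolutely_integrable_on {0..1}"
    and h: "h absolutely_integrable_on {0..1}" and uh: "(\<lambda>x. u x * h x) absolutely_integrable_on {0..1}"
    and mean: "integral {0..1} h = 0"
  shows "dual_bound u T h"
proof -
  have hm: "h \<in> borel_measurable (lebesgue_on {0..1})"
    using h by (auto simp: absolutely_integrable_measurable_real)
  obtain \<eta> :: "real \<Rightarrow> real" where eta: "continuous_on UNIV \<eta>" "\<And>x. x \<notin> {1/4..3/4} \<Longrightarrow> \<eta> x = 0"
    "integral {0..1} \<eta> = 1" using bump_exists by metis
  have eta': "continuous_on {0..1} \<eta>" using eta(1) by (rule continuous_on_subset) auto
  have "bounded (\<eta> ` {0..1})" by (intro compact_imp_bounded compact_continuous_image eta') auto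
  then obtain B where B: "\<And>x. x \<in> {0..1} \<Longrightarrow> \<bar>\<eta> x\<bar> \<le> B"
    unfolding bounded_iff real_norm_def by blast
  define k where "k = (\<lambda>n x. max (- real n) (min (real n) (h x)))"
  have km: "k n \<in> borel_measurable (lebesgue_on {0..1})" for n
    unfolding k_def by (intro borel_measurable_max borel_measurable_min hm) auto
  have kabs: "k n absolutely_integrable_on {0..1}" for n
    by (rule measurable_bounded_by_integrable_imp_absolutely_integrable[OF km, where g = "\<lambda>x. real n"])
       (auto simp: k_def)
  have ki: "k n integrable_on {0..1}" for n by (rule set_lebesgue_integral_eq_integral(1)[OF kabs])
  have ei: "(\<lambda>x. c * \<eta> x) integrable_on {0..1}" for c
    by (intro integrable_continuous_real continuous_intros eta')
  have em: "\<eta> \<in> borel_measurable (lebesgue_on {0..1})"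
    by (rule continuous_imp_measurable_on_sets_lebesgue[OF eta']) auto
  show ?thesis
  proof (rule dual_bound_limit[OF u, of "{}" k "\<lambda>x. \<bar>h x\<bar>" h \<eta>])
    show "(\<lambda>x. u x * k n x) absolutely_integrable_on {0..1}" for n
    proof -
      have "bounded (k n ` {0..1})" by (rule boundedI[of _ "real n"]) (auto simp: k_def)
      then have "(\<lambda>x. k n x * u x) absolutely_integrable_on {0..1}"
        by (intro absolutely_integrable_bounded_measurable_product_real km u) auto
      then show ?thesis by (simp add: mult.commute)
    qed
    have "(\<lambda>x. \<bar>u x * h x\<bar>) absolutely_integrable_on {0..1}" by (intro set_integrable_abs uh)
    then have 1: "(\<lambda>x. \<bar>u x * h x\<bar>) integrable_on {0..1}" by (rule set_lebesgue_integral_eq_integral(1))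
    have um: "u \<in> borel_measurable (lebesgue_on {0..1})"
      using u by (auto simp: absolutely_integrable_measurable_real)
    show "(\<lambda>x. u x * \<bar>h x\<bar>) absolutely_integrable_on {0..1}"
      by (rule measurable_bounded_by_integrable_imp_absolutely_integrable[OF _ _ 1])
         (auto intro!: borel_measurable_times um borel_measurable_abs hm simp: abs_mult)
    show "\<bar>k n x\<bar> \<le> \<bar>h x\<bar>" for n x by (auto simp: k_def)
    show "(\<lambda>n. k n x) \<longlonglongrightarrow> h x" for x
    proof -
      obtain n0 where n0: "\<bar>h x\<bar> \<le> real n0" using real_arch_simple by blast
      have "k n x = h x" if "n \<ge> n0" for n
      proof -
        have "real n0 \<le> real n" using that by simp
        then have "\<bar>h x\<bar> \<le> real n" using n0 by linarith
        then show ?thesis by (auto simp: k_def)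
      qed
      then show ?thesis by (intro tendsto_eventually) (auto simp: eventually_sequentially)
    qed
    show "dual_bound u T (\<lambda>x. k n x - integral {0..1} (k n) * \<eta> x)" for n
    proof (rule dual_bound_bounded[OF T u, of _ "real n + \<bar>integral {0..1} (k n)\<bar> * B"])
      show "(\<lambda>x. k n x - integral {0..1} (k n) * \<eta> x) \<in> borel_measurable (lebesgue_on {0..1})"
        by (intro borel_measurable_diff km borel_measurable_times em borel_measurable_const)
      show "\<bar>k n x - integral {0..1} (k n) * \<eta> x\<bar> \<le> real n + \<bar>integral {0..1} (k n)\<bar> * B"
        if "x \<in> {0..1}" for x
      proof -
        have "\<bar>k n x - integral {0..1} (k n) * \<eta> x\<bar> \<le> \<bar>k n x\<bar> + \<bar>integral {0..1} (k n)\<bar> * \<bar>\<eta> x\<bar>"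
          by (metis abs_mult abs_triangle_ineq4)
        also have "\<dots> \<le> real n + \<bar>integral {0..1} (k n)\<bar> * B"
          by (intro add_mono mult_left_mono B that) (auto simp: k_def)
        finally show ?thesis .
      qed
      show "integral {0..1} (\<lambda>x. k n x - integral {0..1} (k n) * \<eta> x) = 0"
        using Henstock_Kurzweil_Integration.integral_diff[OF ki ei, of n "integral {0..1} (k n)"] eta(3) by simp
    qed
  qed (use kabs h mean eta' in \<open>auto intro!: set_integrable_abs\<close>)
qed

section \<open>The first variation of the ROF functional\<close>
lemma integrable_lebesgue_on_unit_iff:
  "integrable (lebesgue_on {0<..<1}) g \<longleftrightarrow> g absolutely_integrable_on {0..1::real}" for g :: "real \<Rightarrow> real"
proof -
  have "integrable (lebesgue_on {0<..<1}) g \<longleftrightarrow> g absolutely_integrable_on {0<..<1::real}"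
    unfolding set_integrable_def by (subst integrable_restrict_space) auto
  then show ?thesis by (simp add: absolutely_integrable_on_Icc_iff_Ioo)
qed

lemma lebesgue_integral_unit:
  fixes g :: "real \<Rightarrow> real"
  assumes "g absolutely_integrable_on {0..1}"
  shows "(LINT x:{0<..<1}|lebesgue. g x) = integral {0..1} g"
proof -
  have "g absolutely_integrable_on {0<..<1}" using assms by (simp add: absolutely_integrable_on_Icc_iff_Ioo)
  then show ?thesis by (simp add: set_lebesgue_integral_eq_integral(2) integral_open_interval_real)
qed

lemma L1_iff: "u \<in> L1 \<longleftrightarrow> u absolutely_integrable_on {0..1}"
  by (simp add: L1_def absolutely_integrable_on_Icc_iff_Ioo)

lemma C1c_deriv:
  assumes "\<psi> \<in> C1c"
  shows "(\<psi> has_real_derivative deriv \<psi> x) (at x)" "continuous_on UNIV (deriv \<psi>)"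
    "x \<notin> {0<..<1} \<Longrightarrow> \<psi> x = 0"
proof -
  obtain D where D: "\<And>x. (\<psi> has_real_derivative D x) (at x)" "continuous_on UNIV D"
    using assms unfolding C1c_def C1_differentiable_on_def
    by (auto simp: has_real_derivative_iff_has_vector_derivative)
  have "deriv \<psi> = D" using D(1) by (auto intro!: DERIV_imp_deriv)
  then show "(\<psi> has_real_derivative deriv \<psi> x) (at x)" "continuous_on UNIV (deriv \<psi>)" using D by auto
  show "\<psi> x = 0" if "x \<notin> {0<..<1}"
  proof (rule ccontr)
    assume "\<psi> x \<noteq> 0"
    then have "x \<in> closure {x. \<psi> x \<noteq> 0}" by (intro subsetD[OF closure_subset]) auto
    then show False using assms that unfolding C1c_def by auto
  qed
qed

lemma C1c_mult_absolutely_integrable: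
  assumes "\<psi> \<in> C1c" "u absolutely_integrable_on {0..1}"
  shows "(\<lambda>x. u x * deriv \<psi> x) absolutely_integrable_on {0..1}"
  using assms(2) by (rule absolutely_integrable_times_continuous)
    (rule continuous_on_subset[OF C1c_deriv(2)[OF assms(1)]], simp)

lemma C1c_deriv_integral:
  assumes "\<psi> \<in> C1c" "0 \<le> x" 
  shows "(deriv \<psi> has_integral \<psi> x) {0..x}"
proof -
  have "(deriv \<psi> has_integral \<psi> x - \<psi> 0) {0..x}"
    using assms(2) C1c_deriv(1)[OF assms(1)]
    by (intro fundamental_theorem_of_calculus)
       (auto simp: has_real_derivative_iff_has_vector_derivative intro: has_vector_derivative_at_within)
  then show ?thesis using C1c_deriv(3)[OF assms(1), of 0] by simp
qed

lemma TV_le_iff: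
  assumes "u absolutely_integrable_on {0..1}"
  shows "TV_le u T \<longleftrightarrow> TV u \<le> ereal T"
proof -
  have "TV u \<le> ereal T \<longleftrightarrow> (\<forall>\<psi>\<in>{\<psi> \<in> C1c. \<forall>x. \<bar>\<psi> x\<bar> \<le> 1}. (LINT x:{0<..<1}|lebesgue. u x * deriv \<psi> x) \<le> T)"
    unfolding TV_def SUP_le_iff by simp
  also have "\<dots> \<longleftrightarrow> TV_le u T"
    unfolding TV_le_def
    using lebesgue_integral_unit[OF C1c_mult_absolutely_integrable[OF _ assms]] by auto
  finally show ?thesis by simp
qed

lemma zero_in_C1c: "(\<lambda>x. 0) \<in> C1c"
  by (simp add: C1c_def)

lemma TV_nonneg: "0 \<le> TV u"
proof -
  have "(\<lambda>x. 0) \<in> {\<psi> \<in> C1c. \<forall>x. \<bar>\<psi> x\<bar> \<le> 1}" using zero_in_C1c by simp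
  then have "ereal (LINT x:{0<..<1}|lebesgue. u x * deriv (\<lambda>x. 0) x) \<le> TV u"
    unfolding TV_def by (rule SUP_upper)
  then show ?thesis by (simp add: zero_ereal_def)
qed

lemma product_of_square_integrable:
  fixes a b :: "real \<Rightarrow> real"
  assumes "a absolutely_integrable_on {0..1}" "b absolutely_integrable_on {0..1}"
    "(\<lambda>x. (a x)\<^sup>2) absolutely_integrable_on {0..1}" "(\<lambda>x. (b x)\<^sup>2) absolutely_integrable_on {0..1}"
  shows "(\<lambda>x. a x * b x) absolutely_integrable_on {0..1}"
proof (rule measurable_bounded_by_integrable_imp_absolutely_integrable)
  show "(\<lambda>x. a x * b x) \<in> borel_measurable (lebesgue_on {0..1})"
    using assms(1,2) by (intro borel_measurable_times) (auto simp: absolutely_integrable_measurable_real)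
  show "(\<lambda>x. (a x)\<^sup>2 + (b x)\<^sup>2) integrable_on {0..1}"
    by (intro integrable_add set_lebesgue_integral_eq_integral(1) assms)
  show "norm (a x * b x) \<le> (a x)\<^sup>2 + (b x)\<^sup>2" for x
  proof -
    have "0 \<le> (\<bar>a x\<bar> - \<bar>b x\<bar>)\<^sup>2" by simp
    then have "2 * (\<bar>a x\<bar> * \<bar>b x\<bar>) \<le> (a x)\<^sup>2 + (b x)\<^sup>2"
      by (simp add: power2_diff)
    moreover have "0 \<le> \<bar>a x\<bar> * \<bar>b x\<bar>" by simp
    ultimately show ?thesis unfolding real_norm_def abs_mult by linarith
  qed
qed auto

lemma Linf_square_integrable:
  assumes "f \<in> Linf"
  shows "f absolutely_integrable_on {0..1}" "(\<lambda>x. (f x)\<^sup>2) absolutely_integrable_on {0..1}"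
proof -
  let ?M = "lebesgue_on {0<..<1::real}"
  interpret finite_measure ?M
    by (rule finite_measureI) (auto simp: emeasure_restrict_space)
  obtain C where m: "f \<in> borel_measurable ?M" and C: "AE x in ?M. \<bar>f x\<bar> \<le> C"
    using assms by (auto simp: Linf_def)
  have "integrable ?M f"
    by (rule integrable_const_bound[where B = C]) (use C m in auto)
  then show "f absolutely_integrable_on {0..1}" by (simp add: integrable_lebesgue_on_unit_iff)
  have "integrable ?M (\<lambda>x. (f x)\<^sup>2)"
  proof (rule integrable_const_bound[where B = "C\<^sup>2"])
    show "AE x in ?M. norm ((f x)\<^sup>2) \<le> C\<^sup>2"
      using C by eventually_elim (auto simp: abs_le_square_iff[symmetric])
  qed (use m in auto)
  then show "(\<lambda>x. (f x)\<^sup>2) absolutely_integrable_on {0..1}" by (simp add: integrable_lebesgue_on_unit_iff)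
qed

lemma rof_functional_square_integrable:
  assumes "(\<lambda>x. (v x - f x)\<^sup>2) absolutely_integrable_on {0..1}"
  shows "rof_functional \<alpha> f v = ereal (1/2 * integral {0..1} (\<lambda>x. (v x - f x)\<^sup>2)) + ereal \<alpha> * TV v"
proof -
  let ?M = "lebesgue_on {0<..<1::real}"
  have i: "integrable ?M (\<lambda>x. (v x - f x)\<^sup>2)" using assms by (simp add: integrable_lebesgue_on_unit_iff)
  have "(\<integral>\<^sup>+x\<in>{0<..<1}. ennreal ((v x - f x)\<^sup>2) \<partial>lebesgue) = (\<integral>\<^sup>+x. ennreal ((v x - f x)\<^sup>2) \<partial>?M)"
    by (subst nn_integral_restrict_space) auto
  also have "\<dots> = ennreal (integral\<^sup>L ?M (\<lambda>x. (v x - f x)\<^sup>2))"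
    by (rule nn_integral_eq_integral[OF i]) auto
  also have "integral\<^sup>L ?M (\<lambda>x. (v x - f x)\<^sup>2) = integral {0..1} (\<lambda>x. (v x - f x)\<^sup>2)"
    using lebesgue_integral_eq_integral[OF i] by (simp add: integral_open_interval_real)
  finally have e: "(\<integral>\<^sup>+x\<in>{0<..<1}. ennreal ((v x - f x)\<^sup>2) \<partial>lebesgue)
      = ennreal (integral {0..1} (\<lambda>x. (v x - f x)\<^sup>2))" .
  have "0 \<le> integral {0..1} (\<lambda>x. (v x - f x)\<^sup>2)"
    using set_lebesgue_integral_eq_integral(1)[OF assms] by (rule Henstock_Kurzweil_Integration.integral_nonneg) simp
  then show ?thesis unfolding rof_functional_def e by simp
qed

text \<open>
  Square integrability of the minimizer comes from comparing it with the zero function, whose energy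
  is finite because the data are bounded.
\<close>
lemma rof_solution_finite:
  assumes f: "f \<in> Linf" and "0 < \<alpha>" and sol: "rof_solution \<alpha> f u"
  obtains T where "TV u = ereal T" "u absolutely_integrable_on {0..1}"
    "(\<lambda>x. (u x)\<^sup>2) absolutely_integrable_on {0..1}"
proof -
  have uBV: "u \<in> BV" and min: "\<And>v. v \<in> BV \<Longrightarrow> rof_functional \<alpha> f u \<le> rof_functional \<alpha> f v"
    using sol by (auto simp: rof_solution_def)
  have u: "u absolutely_integrable_on {0..1}" using uBV by (simp add: BV_def L1_iff)
  obtain T where T: "TV u = ereal T" using uBV TV_nonneg[of u] by (cases "TV u") (auto simp: BV_def)
  note f1 = Linf_square_integrable[OF f]
  have TV0: "TV (\<lambda>x. 0) = 0" by (rule antisym[OF _ TV_nonneg]) (simp add: TV_def SUP_le_iff)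
  have zero: "(\<lambda>x. 0) \<in> BV" by (simp add: BV_def L1_def TV0)
  have i0: "(\<lambda>x. (0 - f x)\<^sup>2) absolutely_integrable_on {0..1}" using f1(2) by simp
  have "rof_functional \<alpha> f u \<le> rof_functional \<alpha> f (\<lambda>x. 0)" by (rule min[OF zero])
  also have "\<dots> < \<infinity>"
    using rof_functional_square_integrable[OF i0, of \<alpha>] by (simp add: TV0)
  finally have "rof_functional \<alpha> f u < \<infinity>" .
  then have fin: "(\<integral>\<^sup>+x\<in>{0<..<1}. ennreal ((u x - f x)\<^sup>2) \<partial>lebesgue) < \<infinity>"
    unfolding rof_functional_def T
    by (cases "(\<integral>\<^sup>+x\<in>{0<..<1}. ennreal ((u x - f x)\<^sup>2) \<partial>lebesgue)" rule: ennreal_cases) auto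
  let ?M = "lebesgue_on {0<..<1::real}"
  have um: "u \<in> borel_measurable ?M" "f \<in> borel_measurable ?M"
    using u f1(1) by (auto simp: integrable_lebesgue_on_unit_iff[symmetric])
  have "integrable ?M (\<lambda>x. (u x - f x)\<^sup>2)"
  proof (rule integrableI_bounded)
    show "(\<integral>\<^sup>+x. ennreal (norm ((u x - f x)\<^sup>2)) \<partial>?M) < \<infinity>"
      using fin by (subst nn_integral_restrict_space) auto
  qed (use um in measurable)
  then have d2: "(\<lambda>x. (u x - f x)\<^sup>2) absolutely_integrable_on {0..1}"
    by (simp add: integrable_lebesgue_on_unit_iff)
  have d1: "(\<lambda>x. u x - f x) absolutely_integrable_on {0..1}"
    by (intro set_integral_diff(1) u f1)
  have "(\<lambda>x. (u x - f x)\<^sup>2 + 2 * ((u x - f x) * f x) + (f x)\<^sup>2) absolutely_integrable_on {0..1}"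
    by (intro set_integral_add(1) d2 set_integrable_mult_right product_of_square_integrable d1 f1)
  moreover have "(\<lambda>x. (u x - f x)\<^sup>2 + 2 * ((u x - f x) * f x) + (f x)\<^sup>2) = (\<lambda>x. (u x)\<^sup>2)"
    by (auto simp: power2_eq_square algebra_simps)
  ultimately show ?thesis using that T u by simp
qed

text \<open>
  Dividing by \<open>t\<close> and letting \<open>t\<close> tend to zero, as for any first variation.
\<close>
lemma linear_le_of_quadratic:
  fixes a b c :: real
  assumes "\<And>t. 0 < t \<Longrightarrow> t \<le> 1 \<Longrightarrow> t * a \<le> t * b + t\<^sup>2 * c"
  shows "a \<le> b"
proof (rule tendsto_lowerbound)
  show "((\<lambda>t. b + t * c) \<longlongrightarrow> b) (at_right 0)" by (auto intro!: tendsto_eq_intros)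
  have "a \<le> b + t * c" if "0 < t" "t < 1" for t
    using assms[of t] that by (simp add: power2_eq_square ring_distribs[symmetric] mult.assoc)
  then show "\<forall>\<^sub>F t in at_right 0. a \<le> b + t * c"
    by (intro eventually_at_rightI[of 0 1]) auto
qed auto

text \<open>
  The total variation is only convex, so the first order condition is one-sided: moving in direction
  \<open>w\<close> costs at most \<open>t * k\<close> in total variation, so the quadratic term must not gain more than
  \<open>\<alpha> * (t * k)\<close> to first order.
\<close>
lemma rof_first_variation:
  assumes f: "f \<in> Linf" and \<alpha>: "0 < \<alpha>" and sol: "rof_solution \<alpha> f u" and T: "TV u = ereal T"
    and w: "w absolutely_integrable_on {0..1}" "(\<lambda>x. (w x)\<^sup>2) absolutely_integrable_on {0..1}"
    and TVw: "\<And>t. 0 < t \<Longrightarrow> t \<le> 1 \<Longrightarrow> TV_le (\<lambda>x. u x + t * w x) (T + t * k)"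
  shows "integral {0..1} (\<lambda>x. (f x - u x) * w x) \<le> \<alpha> * k"
proof -
  have u: "u absolutely_integrable_on {0..1}" "(\<lambda>x. (u x)\<^sup>2) absolutely_integrable_on {0..1}"
    using rof_solution_finite[OF f \<alpha> sol] by metis+
  note f1 = Linf_square_integrable[OF f]
  have d1: "(\<lambda>x. u x - f x) absolutely_integrable_on {0..1}"
    by (intro set_integral_diff(1) u f1)
  have "(\<lambda>x. (u x)\<^sup>2 - 2 * (u x * f x) + (f x)\<^sup>2) absolutely_integrable_on {0..1}"
    by (intro set_integral_add(1) set_integral_diff(1) u f1 set_integrable_mult_right product_of_square_integrable)
  then have d2: "(\<lambda>x. (u x - f x)\<^sup>2) absolutely_integrable_on {0..1}"
    by (simp add: power2_eq_square algebra_simps)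
  have dw: "(\<lambda>x. (u x - f x) * w x) absolutely_integrable_on {0..1}"
    by (intro product_of_square_integrable d1 d2 w)
  note int = set_lebesgue_integral_eq_integral(1)
  define Q where "Q = integral {0..1} (\<lambda>x. (u x - f x) * w x)"
  define R where "R = integral {0..1} (\<lambda>x. (w x)\<^sup>2)"
  define E where "E = integral {0..1} (\<lambda>x. (u x - f x)\<^sup>2)"
  have "t * (- Q) \<le> t * (\<alpha> * k) + t\<^sup>2 * (R / 2)" if t: "0 < t" "t \<le> 1" for t
  proof -
    let ?v = "\<lambda>x. u x + t * w x"
    have eq: "(\<lambda>x. (?v x - f x)\<^sup>2) = (\<lambda>x. (u x - f x)\<^sup>2 + (2 * t) * ((u x - f x) * w x) + t\<^sup>2 * (w x)\<^sup>2)"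
      by (auto simp: power2_eq_square algebra_simps)
    have v1: "?v absolutely_integrable_on {0..1}" by (intro set_integral_add(1) u set_integrable_mult_right w)
    have v2: "(\<lambda>x. (?v x - f x)\<^sup>2) absolutely_integrable_on {0..1}"
      unfolding eq by (intro set_integral_add(1) d2 set_integrable_mult_right dw w)
    have TVv: "TV ?v \<le> ereal (T + t * k)" using TVw[OF t] TV_le_iff[OF v1] by simp
    have vBV: "?v \<in> BV" using v1 TVv by (auto simp: BV_def L1_iff)
    have Iv: "integral {0..1} (\<lambda>x. (?v x - f x)\<^sup>2) = E + 2 * t * Q + t\<^sup>2 * R"
      unfolding eq E_def Q_def R_def
      by (subst Henstock_Kurzweil_Integration.integral_add,
          intro int set_integral_add(1) d2 set_integrable_mult_right dw, intro int set_integrable_mult_right w)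
         (subst Henstock_Kurzweil_Integration.integral_add,
          intro int d2, intro int set_integrable_mult_right dw, simp)
    have "rof_functional \<alpha> f u \<le> rof_functional \<alpha> f ?v" using sol vBV by (auto simp: rof_solution_def)
    also have "\<dots> = ereal (1/2 * (E + 2 * t * Q + t\<^sup>2 * R)) + ereal \<alpha> * TV ?v"
      unfolding rof_functional_square_integrable[OF v2] Iv ..
    also have "\<dots> \<le> ereal (1/2 * (E + 2 * t * Q + t\<^sup>2 * R)) + ereal \<alpha> * ereal (T + t * k)"
      using TVv \<alpha> by (intro add_left_mono ereal_mult_left_mono) auto
    finally have "1/2 * E + \<alpha> * T \<le> 1/2 * (E + 2 * t * Q + t\<^sup>2 * R) + \<alpha> * (T + t * k)"
      unfolding rof_functional_square_integrable[OF d2] T E_def[symmetric] by simp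
    then show ?thesis by (simp add: field_simps)
  qed
  then have "- Q \<le> \<alpha> * k" by (rule linear_le_of_quadratic)
  moreover have "integral {0..1} (\<lambda>x. (f x - u x) * w x) = - Q"
    unfolding Q_def integral_neg[symmetric] by (intro integral_cong) (simp add: algebra_simps)
  ultimately show ?thesis by simp
qed

definition step :: "real \<Rightarrow> real \<Rightarrow> real" where
  "step p t = (if t \<le> p then 1 else 0)"

lemma step_times_absolutely_integrable:
  assumes "g absolutely_integrable_on {0..1::real}"
  shows "(\<lambda>t. g t * step p t) absolutely_integrable_on {0..1}"
proof -
  have "(\<lambda>t. step p t * g t) absolutely_integrable_on {0..1}"
  proof (rule absolutely_integrable_bounded_measurable_product_real)
    have "step p \<in> borel_measurable borel" unfolding step_def by measurable
    then have "step p \<in> borel_measurable lebesgue" by (intro measurable_completion) simp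
    then show "step p \<in> borel_measurable (lebesgue_on {0..1})" by (rule measurable_restrict_space1)
    show "bounded (step p ` {0..1})" by (rule boundedI[of _ 1]) (auto simp: step_def)
  qed (use assms in auto)
  then show ?thesis by (simp add: mult.commute)
qed

lemma integral_times_step:
  assumes "g absolutely_integrable_on {0..1::real}" "0 \<le> p" "p \<le> 1"
  shows "integral {0..1} (\<lambda>t. g t * step p t) = integral {0..p} g"
proof -
  have "integral {0..1} (\<lambda>t. if t \<in> {0..p} then g t else 0) = integral ({0..p} \<inter> {0..1}) g"
    by (simp only: integral_restrict_Int)
  moreover have "{0..p} \<inter> {0..1} = {0..p}" using assms by auto
  moreover have "integral {0..1} (\<lambda>t. if t \<in> {0..p} then g t else 0) = integral {0..1} (\<lambda>t. g t * step p t)"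
    by (rule integral_cong) (auto simp: step_def)
  ultimately show ?thesis by metis
qed

text \<open>
  A step of height \<open>c\<close> at an interior point adds at most \<open>\<bar>c\<bar>\<close> to the total variation; a step at the
  right end point is a constant on the interval and adds nothing.
\<close>
lemma TV_le_add_step:
  assumes u: "u absolutely_integrable_on {0..1}" and T: "TV_le u T" and t: "0 \<le> t" and c: "\<bar>c\<bar> \<le> 1"
    and p: "0 \<le> p" "p \<le> 1" and k: "k = (if p = 1 then 0 else 1)"
  shows "TV_le (\<lambda>x. u x + t * (c * step p x)) (T + t * k)"
  unfolding TV_le_def
proof (intro ballI impI)
  fix \<psi> assume \<psi>: "\<psi> \<in> C1c" "\<forall>x. \<bar>\<psi> x\<bar> \<le> 1"
  note int = set_lebesgue_integral_eq_integral(1)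
  have d: "deriv \<psi> absolutely_integrable_on {0..1}"
    by (intro absolutely_integrable_continuous_real continuous_on_subset[OF C1c_deriv(2)[OF \<psi>(1)]]) simp
  have "integral {0..1} (\<lambda>x. (u x + t * (c * step p x)) * deriv \<psi> x)
      = integral {0..1} (\<lambda>x. u x * deriv \<psi> x + (t * c) * (deriv \<psi> x * step p x))"
    by (intro integral_cong) (simp add: algebra_simps)
  also have "\<dots> = integral {0..1} (\<lambda>x. u x * deriv \<psi> x) + (t * c) * \<psi> p"
    using C1c_deriv_integral[OF \<psi>(1) p(1)] integral_times_step[OF d p]
    by (subst Henstock_Kurzweil_Integration.integral_add)
       (auto intro!: int C1c_mult_absolutely_integrable \<psi> u set_integrable_mult_right
          step_times_absolutely_integrable d simp: integral_unique)
  also have "\<dots> \<le> T + t * k"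
  proof (rule add_mono)
    show "integral {0..1} (\<lambda>x. u x * deriv \<psi> x) \<le> T" using T \<psi> by (auto simp: TV_le_def)
    have "c * \<psi> p \<le> k"
    proof (cases "p = 1")
      case True
      then show ?thesis using C1c_deriv(3)[OF \<psi>(1), of p] k by simp
    next
      case False
      have "\<bar>c * \<psi> p\<bar> \<le> 1 * 1" unfolding abs_mult by (rule mult_mono) (use c \<psi> in auto)
      then show ?thesis using k False by simp
    qed
    then show "t * c * \<psi> p \<le> t * k" using t by (simp add: mult.assoc mult_left_mono)
  qed
  finally show "integral {0..1} (\<lambda>x. (u x + t * (c * step p x)) * deriv \<psi> x) \<le> T + t * k" .
qed

text \<open>
  The taut string characterization of the minimizer, in terms of a primitive \<open>F\<close> of the data and a
  primitive \<open>U\<close> of the solution: \<open>U\<close> stays in the tube of radius \<open>\<alpha>\<close> around \<open>F\<close> with the same end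
  points, bends upwards only where it touches the upper boundary \<open>F + \<alpha>\<close>, and bends downwards only
  where it touches the lower boundary \<open>F - \<alpha>\<close>. In other words it is convex wherever it stays off the
  lower boundary and concave wherever it stays off the upper one. Convexity is stated by slopes of
  three points.
\<close>
definition taut_string :: "real \<Rightarrow> (real \<Rightarrow> real) \<Rightarrow> (real \<Rightarrow> real) \<Rightarrow> bool" where
  "taut_string \<alpha> F U \<longleftrightarrow>
     continuous_on {0..1} F \<and> continuous_on {0..1} U \<and> F 0 = U 0 \<and> F 1 = U 1 \<and>
     (\<forall>x\<in>{0..1}. \<bar>F x - U x\<bar> \<le> \<alpha>) \<and>
     (\<forall>x y z. 0 \<le> x \<and> x < y \<and> y < z \<and> z \<le> 1 \<longrightarrow> (\<forall>t\<in>{x..z}. F t - U t < \<alpha>) \<longrightarrow>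
        (U y - U x) / (y - x) \<le> (U z - U y) / (z - y)) \<and>
     (\<forall>x y z. 0 \<le> x \<and> x < y \<and> y < z \<and> z \<le> 1 \<longrightarrow> (\<forall>t\<in>{x..z}. - \<alpha> < F t - U t) \<longrightarrow>
        (U z - U y) / (z - y) \<le> (U y - U x) / (y - x))"

text \<open>
  The function of \<open>p\<close> considered here is the tent with vertex \<open>(y, 1)\<close> that vanishes outside \<open>(x, z)\<close>,
  written in the form in which it arises as a primitive of differences of step functions.
\<close>
lemma tent_bounds:
  fixes x y z p :: real
  assumes "x < y" "y < z"
  defines "\<tau> \<equiv> (min y p - min x p) / (y - x) - (min z p - min y p) / (z - y)"
  shows "0 \<le> \<tau>" "\<tau> \<le> 1" "p \<notin> {x..z} \<Longrightarrow> \<tau> = 0"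
proof -
  consider "p \<le> x" | "x \<le> p" "p \<le> y" | "y \<le> p" "p \<le> z" | "z \<le> p" by linarith
  then have "0 \<le> \<tau> \<and> \<tau> \<le> 1 \<and> (p \<notin> {x..z} \<longrightarrow> \<tau> = 0)"
  proof cases
    case 1
    then have "min y p = p" "min x p = p" "min z p = p" using assms by auto
    then show ?thesis by (simp add: \<tau>_def)
  next
    case 2
    then have "min y p = p" "min x p = x" "min z p = p" using assms by auto
    then show ?thesis using assms(1,2) 2 by (auto simp: \<tau>_def)
  next
    case 3
    then have "min y p = y" "min x p = x" "min z p = p" using assms by auto
    then show ?thesis using assms(1,2) 3 by (auto simp: \<tau>_def)
  next
    case 4
    then have "min y p = y" "min x p = x" "min z p = z" using assms by auto
    then show ?thesis using assms(1,2) by (auto simp: \<tau>_def)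
  qed
  then show "0 \<le> \<tau>" "\<tau> \<le> 1" "p \<notin> {x..z} \<Longrightarrow> \<tau> = 0" by auto
qed

text \<open>
  Write \<open>W = F - U\<close>, the primitive of \<open>f - u\<close>. Testing minimality with step functions gives the tube
  condition, and testing it with the multiples \<open>(1 - t) * u\<close> gives \<open>\<alpha> * TV u \<le> \<integral> u W'\<close>. So \<open>W / \<alpha>\<close> is a
  field with values in \<open>[-1, 1]\<close> that attains the supremum in the duality inequality. If \<open>W < \<alpha>\<close> on
  \<open>[x, z]\<close>, then adding a small positive tent to \<open>W\<close> keeps it admissible, and comparing the two fields
  gives an inequality for the pairing of \<open>u\<close> with the derivative of the tent, which is exactly the
  slope inequality for \<open>U\<close>. The sign \<open>\<sigma>\<close> treats the two sides of the tube at once.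
\<close>
lemma rof_solution_taut_string:
  assumes f: "f \<in> Linf" and \<alpha>: "0 < \<alpha>" and sol: "rof_solution \<alpha> f u"
  shows "taut_string \<alpha> (\<lambda>x. integral {0..x} f) (\<lambda>x. integral {0..x} u)"
proof -
  obtain T where T: "TV u = ereal T" and u: "u absolutely_integrable_on {0..1}"
    "(\<lambda>x. (u x)\<^sup>2) absolutely_integrable_on {0..1}"
    using rof_solution_finite[OF f \<alpha> sol] by metis
  have TVu: "TV_le u T" using T TV_le_iff[OF u(1)] by simp
  note f1 = Linf_square_integrable[OF f]
  note int = set_lebesgue_integral_eq_integral(1)
  define F where "F = (\<lambda>x. integral {0..x} f)"
  define U where "U = (\<lambda>x. integral {0..x} u)"
  define d where "d = (\<lambda>x. f x - u x)"
  have d1: "d absolutely_integrable_on {0..1}" unfolding d_def by (intro set_integral_diff(1) u f1)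
  have int0: "g integrable_on {0..p}" if "g absolutely_integrable_on {0..1}" "p \<le> 1" for g :: "real \<Rightarrow> real" and p
    using int[OF that(1)] by (rule integrable_on_subinterval) (use that(2) in auto)
  have Id: "integral {0..p} d = F p - U p" if "p \<le> 1" for p
    unfolding d_def F_def U_def
    by (intro Henstock_Kurzweil_Integration.integral_diff int0 that f1 u)
  have Iuf: "(\<lambda>x. u x * f x) absolutely_integrable_on {0..1}"
    by (intro product_of_square_integrable u f1)
  have Iud: "(\<lambda>x. u x * d x) absolutely_integrable_on {0..1}"
  proof -
    have "(\<lambda>x. u x * f x - (u x)\<^sup>2) absolutely_integrable_on {0..1}"
      by (intro set_integral_diff(1) u Iuf)
    then show ?thesis by (simp add: d_def power2_eq_square algebra_simps)
  qed
  have one: "(\<lambda>x::real. 1::real) absolutely_integrable_on {0..1}"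
    by (rule absolutely_integrable_continuous_real[OF continuous_on_const])
  have step1: "step p absolutely_integrable_on {0..1}" for p
    using step_times_absolutely_integrable[OF one, of p] by simp
  have bound: "c * (F p - U p) \<le> \<alpha> * (if p = 1 then 0 else 1)" if c: "\<bar>c\<bar> = 1" and p: "0 \<le> p" "p \<le> 1" for c p
  proof -
    have "integral {0..1} (\<lambda>x. (f x - u x) * (c * step p x)) \<le> \<alpha> * (if p = 1 then 0 else 1)"
    proof (rule rof_first_variation[OF f \<alpha> sol T])
      show "(\<lambda>x. c * step p x) absolutely_integrable_on {0..1}" by (intro set_integrable_mult_right step1)
      have "(\<lambda>x. (c * step p x)\<^sup>2) = (\<lambda>x. c\<^sup>2 * step p x)" by (auto simp: step_def power_mult_distrib)
      then show "(\<lambda>x. (c * step p x)\<^sup>2) absolutely_integrable_on {0..1}"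
        by (simp only:) (intro set_integrable_mult_right step1)
      show "TV_le (\<lambda>x. u x + t * (c * step p x)) (T + t * (if p = 1 then 0 else 1))" if "0 < t" for t
        using that c p by (intro TV_le_add_step u TVu) auto
    qed
    also have "integral {0..1} (\<lambda>x. (f x - u x) * (c * step p x)) = c * integral {0..1} (\<lambda>x. d x * step p x)"
      unfolding d_def integral_mult_right[symmetric] by (intro integral_cong) (simp add: algebra_simps)
    also have "\<dots> = c * (F p - U p)" using integral_times_step[OF d1 p] Id[OF p(2)] by simp
    finally show ?thesis .
  qed
  have W1: "F 1 = U 1" using bound[of 1 1] bound[of "-1" 1] by simp
  have Wle: "\<bar>F p - U p\<bar> \<le> \<alpha>" if "p \<in> {0..1}" for p
  proof -
    have "c * (F p - U p) \<le> \<alpha>" if "\<bar>c\<bar> = 1" for c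
      using bound[OF that, of p] \<open>p \<in> {0..1}\<close> \<alpha> by (auto split: if_splits)
    from this[of 1] this[of "-1"] show ?thesis by simp
  qed
  have contF: "continuous_on {0..1} F" and contU: "continuous_on {0..1} U"
    unfolding F_def U_def by (intro indefinite_integral_continuous_1 int f1 u)+
  \<comment> \<open>Shrinking \<open>u\<close> by the factor \<open>1 - t\<close> lowers the total variation by \<open>t * T\<close>.\<close>
  have euler: "\<alpha> * T \<le> integral {0..1} (\<lambda>x. u x * d x)"
  proof -
    have "integral {0..1} (\<lambda>x. (f x - u x) * (- u x)) \<le> \<alpha> * (- T)"
    proof (rule rof_first_variation[OF f \<alpha> sol T])
      show "(\<lambda>x. - u x) absolutely_integrable_on {0..1}"
        using set_integrable_mult_right[OF u(1), of "-1"] by simp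
      show "(\<lambda>x. (- u x)\<^sup>2) absolutely_integrable_on {0..1}" using u(2) by simp
      show "TV_le (\<lambda>x. u x + t * - u x) (T + t * - T)" if t: "0 < t" "t \<le> 1" for t
        unfolding TV_le_def
      proof (intro ballI impI)
        fix \<psi> assume \<psi>: "\<psi> \<in> C1c" "\<forall>x. \<bar>\<psi> x\<bar> \<le> 1"
        have "integral {0..1} (\<lambda>x. (u x + t * - u x) * deriv \<psi> x)
            = integral {0..1} (\<lambda>x. (1 - t) * (u x * deriv \<psi> x))"
          by (intro integral_cong) (simp add: algebra_simps)
        also have "\<dots> \<le> (1 - t) * T"
          using TVu \<psi> t by (auto simp: TV_le_def intro!: mult_left_mono)
        finally show "integral {0..1} (\<lambda>x. (u x + t * - u x) * deriv \<psi> x) \<le> T + t * - T"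
          by (simp add: algebra_simps)
      qed
    qed
    also have "integral {0..1} (\<lambda>x. (f x - u x) * (- u x)) = - integral {0..1} (\<lambda>x. u x * d x)"
      unfolding d_def integral_neg[symmetric] by (intro integral_cong) (simp add: algebra_simps)
    finally show ?thesis by simp
  qed
  have tent: "\<sigma> * ((U y - U x) / (y - x)) \<le> \<sigma> * ((U z - U y) / (z - y))"
    if \<sigma>: "\<bar>\<sigma>\<bar> = 1" and xyz: "0 \<le> x" "x < y" "y < z" "z \<le> 1"
      and lt: "\<forall>t\<in>{x..z}. \<sigma> * (F t - U t) < \<alpha>" for \<sigma> x y z
  proof -
    have "continuous_on {x..z} (\<lambda>t. \<sigma> * (F t - U t))"
      using xyz by (intro continuous_intros continuous_on_subset[OF contF] continuous_on_subset[OF contU]) auto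
    then obtain t0 where t0: "t0 \<in> {x..z}" "\<And>t. t \<in> {x..z} \<Longrightarrow> \<sigma> * (F t - U t) \<le> \<sigma> * (F t0 - U t0)"
      using continuous_attains_sup[of "{x..z}" "\<lambda>t. \<sigma> * (F t - U t)"] xyz by auto
    define \<epsilon> where "\<epsilon> = \<alpha> - \<sigma> * (F t0 - U t0)"
    have \<epsilon>: "0 < \<epsilon>" using lt t0(1) by (auto simp: \<epsilon>_def)
    have max_t: "\<sigma> * (F t - U t) \<le> \<alpha> - \<epsilon>" if "t \<in> {x..z}" for t using t0(2)[OF that] by (simp add: \<epsilon>_def)
    \<comment> \<open>The derivative of the tent over \<open>[x, z]\<close> with vertex at \<open>y\<close>.\<close>
    define s where "s = (\<lambda>t. (step y t - step x t) / (y - x) - (step z t - step y t) / (z - y))"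
    have gs: "(\<lambda>t. g t * s t) absolutely_integrable_on {0..1}"
      "integral {0..1} (\<lambda>t. g t * s t) = (integral {0..y} g - integral {0..x} g) / (y - x)
          - (integral {0..z} g - integral {0..y} g) / (z - y)"
      if g: "g absolutely_integrable_on {0..1}" for g
    proof -
      note st = step_times_absolutely_integrable[OF g]
      have eq: "(\<lambda>t. g t * s t) = (\<lambda>t. (1 / (y - x)) * (g t * step y t - g t * step x t)
           - (1 / (z - y)) * (g t * step z t - g t * step y t))"
        by (auto simp: s_def algebra_simps diff_divide_distrib)
      show "(\<lambda>t. g t * s t) absolutely_integrable_on {0..1}" unfolding eq
        by (intro set_integral_diff(1) set_integrable_mult_right st)
      have e2: "integral {0..1} (\<lambda>t. g t * step p t - g t * step q t) = integral {0..p} g - integral {0..q} g"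
        if "0 \<le> p" "p \<le> 1" "0 \<le> q" "q \<le> 1" for p q
        using that by (simp add: Henstock_Kurzweil_Integration.integral_diff int[OF st] integral_times_step[OF g])
      show "integral {0..1} (\<lambda>t. g t * s t) = (integral {0..y} g - integral {0..x} g) / (y - x)
          - (integral {0..z} g - integral {0..y} g) / (z - y)"
        unfolding eq
        by (subst Henstock_Kurzweil_Integration.integral_diff)
           (use xyz in \<open>auto intro!: int set_integral_diff(1) set_integrable_mult_right st simp: e2\<close>)
    qed
    have s1: "s absolutely_integrable_on {0..1}" using gs(1)[OF one] by simp
    have s_prim: "integral {0..p} s = (min y p - min x p) / (y - x) - (min z p - min y p) / (z - y)"
      if p: "0 \<le> p" "p \<le> 1" for p
    proof -
      have m: "integral {0..q} (step p) = min q p" if "0 \<le> q" "q \<le> 1" for q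
      proof -
        have "integral {0..q} (step p) = integral {0..1} (\<lambda>t. step p t * step q t)"
          using integral_times_step[OF step1 that] by simp
        also have "(\<lambda>t. step p t * step q t) = (\<lambda>t. 1 * step (min q p) t)" by (auto simp: step_def)
        also have "integral {0..1} \<dots> = integral {0..min q p} (\<lambda>x. 1)"
          by (rule integral_times_step[OF one]) (use p that in auto)
        also have "\<dots> = min q p" using p that by simp
        finally show ?thesis .
      qed
      have "integral {0..p} s = integral {0..1} (\<lambda>t. s t * step p t)"
        using integral_times_step[OF s1 p] by simp
      also have "\<dots> = integral {0..1} (\<lambda>t. step p t * s t)" by (simp add: mult.commute)
      also have "\<dots> = (min y p - min x p) / (y - x) - (min z p - min y p) / (z - y)"
        using gs(2)[OF step1] xyz by (simp add: m)
      finally show ?thesis .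
    qed
    define h where "h = (\<lambda>t. d t + (\<sigma> * \<epsilon>) * s t)"
    have h1: "h absolutely_integrable_on {0..1}" unfolding h_def
      by (intro set_integral_add(1) d1 set_integrable_mult_right s1)
    have uh_eq: "(\<lambda>t. u t * h t) = (\<lambda>t. u t * d t + (\<sigma> * \<epsilon>) * (u t * s t))"
      by (auto simp: h_def algebra_simps)
    have uh: "(\<lambda>t. u t * h t) absolutely_integrable_on {0..1}" unfolding uh_eq
      by (intro set_integral_add(1) Iud set_integrable_mult_right gs(1) u)
    have h_prim: "integral {0..p} h = (F p - U p) + \<sigma> * (\<epsilon> * ((min y p - min x p) / (y - x) - (min z p - min y p) / (z - y)))"
      if p: "0 \<le> p" "p \<le> 1" for p
      unfolding h_def using s_prim[OF p] Id[OF p(2)]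
      by (subst Henstock_Kurzweil_Integration.integral_add)
         (auto intro!: int0 d1 set_integrable_mult_right s1 p simp: mult.assoc)
    have mean: "integral {0..1} h = 0"
    proof -
      have "min x 1 = x" "min y 1 = y" "min z 1 = z" using xyz by auto
      then show ?thesis using h_prim[of 1] W1 xyz by simp
    qed
    have "dual_bound u T h"
      by (rule dual_bound_absolutely_integrable[OF TVu u(1) h1 uh mean])
    moreover have "\<bar>integral {0..p} h\<bar> \<le> \<alpha>" if p: "p \<in> {0..1}" for p
    proof -
      define \<tau> where "\<tau> = (min y p - min x p) / (y - x) - (min z p - min y p) / (z - y)"
      have \<tau>: "0 \<le> \<tau>" "\<tau> \<le> 1" "p \<notin> {x..z} \<Longrightarrow> \<tau> = 0"
        unfolding \<tau>_def using tent_bounds[OF xyz(2,3)] by auto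
      have "\<sigma> = 1 \<or> \<sigma> = -1" using \<sigma> by auto
      then have "\<bar>integral {0..p} h\<bar> = \<bar>\<sigma> * (F p - U p) + \<epsilon> * \<tau>\<bar>"
        using p h_prim[of p] unfolding \<tau>_def[symmetric] by auto
      also have "\<dots> \<le> \<alpha>"
      proof -
        have a: "\<bar>\<sigma> * (F p - U p)\<bar> \<le> \<alpha>" using Wle[OF p] \<sigma> by (simp add: abs_mult)
        have b: "0 \<le> \<epsilon> * \<tau>" "\<epsilon> * \<tau> \<le> \<epsilon>" using \<epsilon> \<tau> by (auto simp: mult_left_le)
        have "\<sigma> * (F p - U p) + \<epsilon> * \<tau> \<le> \<alpha>"
        proof (cases "p \<in> {x..z}")
          case True
          then show ?thesis using max_t[OF True] b by linarith
        next
          case False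
          then show ?thesis using \<tau>(3) a by simp
        qed
        then show ?thesis using a b by linarith
      qed
      finally show ?thesis .
    qed
    ultimately have "integral {0..1} (\<lambda>t. u t * h t) \<le> \<alpha> * T" using \<alpha> by (auto simp: dual_bound_def)
    also have "\<dots> \<le> integral {0..1} (\<lambda>x. u x * d x)" by (rule euler)
    finally have "(\<sigma> * \<epsilon>) * integral {0..1} (\<lambda>t. u t * s t) \<le> 0"
      unfolding uh_eq
      by (subst (asm) Henstock_Kurzweil_Integration.integral_add)
         (auto intro!: int Iud set_integrable_mult_right gs(1) u)
    then have "\<epsilon> * (\<sigma> * integral {0..1} (\<lambda>t. u t * s t)) \<le> 0" by (simp add: mult_ac)
    then have "\<sigma> * integral {0..1} (\<lambda>t. u t * s t) \<le> 0" using \<epsilon> by (simp add: mult_le_0_iff)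
    then show ?thesis unfolding gs(2)[OF u(1)] U_def by (simp add: algebra_simps)
  qed
  have "F 0 = U 0" by (simp add: F_def U_def)
  moreover have "(U y - U x) / (y - x) \<le> (U z - U y) / (z - y)"
    if "0 \<le> x \<and> x < y \<and> y < z \<and> z \<le> 1" "\<forall>t\<in>{x..z}. F t - U t < \<alpha>" for x y z
    using tent[of 1 x y z] that by auto
  moreover have "(U z - U y) / (z - y) \<le> (U y - U x) / (y - x)"
    if "0 \<le> x \<and> x < y \<and> y < z \<and> z \<le> 1" "\<forall>t\<in>{x..z}. - \<alpha> < F t - U t" for x y z
  proof -
    have "(-1) * ((U y - U x) / (y - x)) \<le> (-1) * ((U z - U y) / (z - y))"
      by (rule tent) (use that in fastforce)+
    then show ?thesis by linarith
  qed
  ultimately show ?thesis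
    unfolding taut_string_def F_def[symmetric] U_def[symmetric]
    using contF contU W1 Wle by blast
qed

section \<open>Comparison of taut strings\<close>
definition left_slope :: "(real \<Rightarrow> real) \<Rightarrow> real \<Rightarrow> real \<Rightarrow> bool" where
  "left_slope U x l \<longleftrightarrow> ((\<lambda>y. (U x - U y) / (x - y)) \<longlongrightarrow> l) (at_left x)"

definition right_slope :: "(real \<Rightarrow> real) \<Rightarrow> real \<Rightarrow> real \<Rightarrow> bool" where
  "right_slope U x r \<longleftrightarrow> ((\<lambda>y. (U y - U x) / (y - x)) \<longlongrightarrow> r) (at_right x)"

lemma slope_diff:
  "left_slope U x l \<Longrightarrow> left_slope V x l' \<Longrightarrow> left_slope (\<lambda>t. U t - V t) x (l - l')"
  "right_slope U x r \<Longrightarrow> right_slope V x r' \<Longrightarrow> right_slope (\<lambda>t. U t - V t) x (r - r')"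
  unfolding left_slope_def right_slope_def
  by (drule (1) tendsto_diff, simp add: diff_divide_distrib[symmetric] algebra_simps)+

lemma slope_uminus:
  "left_slope U x l \<Longrightarrow> left_slope (\<lambda>t. - U t) x (- l)"
  "right_slope U x r \<Longrightarrow> right_slope (\<lambda>t. - U t) x (- r)"
  unfolding left_slope_def right_slope_def
  by (drule tendsto_minus, simp add: minus_divide_left)+

lemma slopes_at_max:
  assumes "left_slope D x l" "right_slope D x r" "0 < x" "x < (1::real)"
    and "\<And>t. t \<in> {0..1} \<Longrightarrow> D t \<le> D x"
  shows "0 \<le> l" "r \<le> 0"
proof -
  show "0 \<le> l"
  proof (rule tendsto_lowerbound)
    show "((\<lambda>y. (D x - D y) / (x - y)) \<longlongrightarrow> l) (at_left x)" using assms(1) by (simp add: left_slope_def)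
    show "\<forall>\<^sub>F y in at_left x. 0 \<le> (D x - D y) / (x - y)"
      by (rule eventually_at_leftI[of 0]) (use assms in auto)
  qed simp
  show "r \<le> 0"
  proof (rule tendsto_upperbound)
    show "((\<lambda>y. (D y - D x) / (y - x)) \<longlongrightarrow> r) (at_right x)" using assms(2) by (simp add: right_slope_def)
    show "\<forall>\<^sub>F y in at_right x. (D y - D x) / (y - x) \<le> 0"
      by (rule eventually_at_rightI[of _ 1]) (use assms in \<open>auto simp: divide_le_0_iff\<close>)
  qed simp
qed

lemma taut_string_convex:
  assumes "taut_string \<alpha> F U" "0 \<le> x" "x < y" "y < z" "z \<le> 1" "\<And>t. t \<in> {x..z} \<Longrightarrow> F t - U t < \<alpha>"
  shows "(U y - U x) / (y - x) \<le> (U z - U y) / (z - y)"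
  using assms unfolding taut_string_def by blast

lemma taut_string_concave:
  assumes "taut_string \<alpha> F U" "0 \<le> x" "x < y" "y < z" "z \<le> 1" "\<And>t. t \<in> {x..z} \<Longrightarrow> - \<alpha> < F t - U t"
  shows "(U z - U y) / (z - y) \<le> (U y - U x) / (y - x)"
  using assms unfolding taut_string_def by blast

lemma taut_string_uminus:
  assumes "taut_string \<alpha> F U"
  shows "taut_string \<alpha> (\<lambda>x. - F x) (\<lambda>x. - U x)"
proof -
  have *: "(- U y - - U x) / (y - x) = - ((U y - U x) / (y - x))" for x y
    by (metis minus_diff_minus minus_divide_left)
  have **: "- F t - - U t < \<alpha> \<longleftrightarrow> - \<alpha> < F t - U t" "- \<alpha> < - F t - - U t \<longleftrightarrow> F t - U t < \<alpha>"
    "\<bar>- F t - - U t\<bar> = \<bar>F t - U t\<bar>" for t by auto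
  show ?thesis
    using assms unfolding taut_string_def * ** neg_le_iff_le neg_equal_iff_equal
    by (auto intro!: continuous_intros)
qed

lemma unit_interval_modulus:
  fixes W :: "real \<Rightarrow> real"
  assumes "continuous_on {0..1} W" "x \<in> {0..1}" "0 < e"
  obtains d where "0 < d" "\<And>t. t \<in> {0..1} \<Longrightarrow> \<bar>t - x\<bar> < d \<Longrightarrow> \<bar>W t - W x\<bar> < e"
  using assms unfolding continuous_on_iff dist_real_def by blast

text \<open>
  Off the upper boundary the string is concave near \<open>x\<close>, so its slope cannot increase there.
\<close>
lemma taut_string_concave_slopes:
  assumes taut: "taut_string \<alpha> F U" and x: "0 < x" "x < 1" and W: "- \<alpha> < F x - U x"
    and l: "left_slope U x l" and r: "right_slope U x r"
  shows "r \<le> l"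
proof -
  have "continuous_on {0..1} (\<lambda>t. F t - U t)" using taut by (auto simp: taut_string_def intro!: continuous_intros)
  then obtain d where d: "0 < d" "\<And>t. t \<in> {0..1} \<Longrightarrow> \<bar>t - x\<bar> < d \<Longrightarrow> \<bar>(F t - U t) - (F x - U x)\<bar> < (F x - U x) + \<alpha>"
    using unit_interval_modulus[of "\<lambda>t. F t - U t" x "(F x - U x) + \<alpha>"] x W by auto
  define \<delta> where "\<delta> = min d (min x (1 - x))"
  have \<delta>: "0 < \<delta>" "\<delta> \<le> d" "\<delta> \<le> x" "\<delta> \<le> 1 - x" using d x by (auto simp: \<delta>_def)
  have ineq: "(U z - U x) / (z - x) \<le> (U x - U y) / (x - y)" if yz: "x - \<delta> < y" "y < x" "x < z" "z < x + \<delta>" for y z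
  proof -
    have "- \<alpha> < F t - U t" if "t \<in> {y..z}" for t
    proof -
      have "t \<in> {0..1}" "\<bar>t - x\<bar> < d" using that yz \<delta> by auto
      then show ?thesis using d(2)[of t] by linarith
    qed
    then show ?thesis using taut yz \<delta> unfolding taut_string_def by auto
  qed
  have "r \<le> (U x - U y) / (x - y)" if "x - \<delta> < y" "y < x" for y
  proof (rule tendsto_upperbound)
    show "((\<lambda>y. (U y - U x) / (y - x)) \<longlongrightarrow> r) (at_right x)" using r by (simp add: right_slope_def)
    show "\<forall>\<^sub>F z in at_right x. (U z - U x) / (z - x) \<le> (U x - U y) / (x - y)"
      by (rule eventually_at_rightI[of _ "x + \<delta>"]) (use ineq that \<delta> in auto)
  qed simp
  then have "\<forall>\<^sub>F y in at_left x. r \<le> (U x - U y) / (x - y)"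
    by (intro eventually_at_leftI[of "x - \<delta>"]) (use \<delta> in auto)
  then show ?thesis
    using l unfolding left_slope_def by (intro tendsto_lowerbound) auto
qed

lemma taut_string_up_jump:
  assumes taut: "taut_string \<alpha> F U" and x: "0 < x" "x < 1"
    and "left_slope U x l" "right_slope U x r" "l < r"
  shows "F x - U x = - \<alpha>"
proof -
  have "\<bar>F x - U x\<bar> \<le> \<alpha>" using taut x by (auto simp: taut_string_def)
  then show ?thesis using taut_string_concave_slopes[OF taut x] assms(4-6) by force
qed

text \<open>
  At an upward jump of the slope, \<open>F - U\<close> attains its minimum \<open>- \<alpha>\<close>; the sign of the one-sided
  derivatives at a minimum compares the slopes of \<open>F\<close> and \<open>U\<close> on each side.
\<close>
lemma taut_string_data_jump:
  assumes taut: "taut_string \<alpha> F U" and x: "0 < x" "x < 1"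
    and U: "left_slope U x l" "right_slope U x r" and lr: "l < r"
    and F: "left_slope F x l'" "right_slope F x r'"
  shows "l' \<le> l" "r \<le> r'"
proof -
  have W: "F x - U x = - \<alpha>" by (rule taut_string_up_jump[OF taut x U lr])
  have "\<bar>F t - U t\<bar> \<le> \<alpha>" if "t \<in> {0..1}" for t using taut that by (auto simp: taut_string_def)
  then have "U t - F t \<le> U x - F x" if "t \<in> {0..1}" for t using that W by fastforce
  from slopes_at_max[OF slope_diff(1)[OF U(1) F(1)] slope_diff(2)[OF U(2) F(2)] x this]
  show "l' \<le> l" "r \<le> r'" by auto
qed

text \<open>
  A maximum principle. Where \<open>D = U2 - U1\<close> exceeds \<open>\<alpha>2 - \<alpha>1\<close>, the string \<open>U1\<close> is off its upper boundary
  and \<open>U2\<close> is off its lower one, so \<open>U1\<close> is concave, \<open>U2\<close> is convex, and \<open>D\<close> is convex. A convex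
  function cannot be largest at an interior point while being smaller just to the left of it, which
  is the situation at the leftmost maximum of \<open>D\<close>.
\<close>
lemma taut_string_comparison:
  assumes taut: "taut_string \<alpha>1 F U1" "taut_string \<alpha>2 F U2" and le: "\<alpha>1 \<le> \<alpha>2" and x: "x \<in> {0..1}"
  shows "U2 x - U1 x \<le> \<alpha>2 - \<alpha>1"
proof (rule ccontr)
  assume neg: "\<not> U2 x - U1 x \<le> \<alpha>2 - \<alpha>1"
  define D where "D = (\<lambda>t. U2 t - U1 t)"
  have cont: "continuous_on {0..1} D" unfolding D_def
    using taut by (auto simp: taut_string_def intro!: continuous_intros)
  obtain xm where xm: "xm \<in> {0..1}" "\<And>t. t \<in> {0..1} \<Longrightarrow> D t \<le> D xm"
    using continuous_attains_sup[of "{0..1}" D] cont by auto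
  have big: "\<alpha>2 - \<alpha>1 < D xm" using xm(2)[OF x] neg by (simp add: D_def)
  define S where "S = {t \<in> {0..1}. D t = D xm}"
  have "closed S" unfolding S_def using continuous_closed_preimage_constant[OF cont, of "D xm"] by simp
  moreover have "bounded S" by (rule bounded_subset[of "{0..1}"]) (auto simp: S_def)
  ultimately have "compact S" by (simp add: compact_eq_bounded_closed)
  moreover have "S \<noteq> {}" using xm by (auto simp: S_def)
  ultimately obtain x0 where x0: "x0 \<in> S" "\<And>t. t \<in> S \<Longrightarrow> x0 \<le> t"
    using compact_attains_inf by metis
  have x0': "x0 \<in> {0..1}" "D x0 = D xm" using x0(1) by (auto simp: S_def)
  have "D 0 = 0" "D 1 = 0" using taut by (auto simp: taut_string_def D_def)
  then have x01: "0 < x0" "x0 < 1" using x0' big le by (auto simp: less_le)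
  obtain d where d: "0 < d" "\<And>t. t \<in> {0..1} \<Longrightarrow> \<bar>t - x0\<bar> < d \<Longrightarrow> \<bar>D t - D x0\<bar> < D x0 - (\<alpha>2 - \<alpha>1)"
    using unit_interval_modulus[OF cont x0'(1), of "D x0 - (\<alpha>2 - \<alpha>1)"] big x0' by auto
  define \<delta> where "\<delta> = min d (min x0 (1 - x0)) / 2"
  have \<delta>: "0 < \<delta>" "\<delta> < d" "\<delta> < x0" "\<delta> < 1 - x0" using d x01 by (auto simp: \<delta>_def)
  have W: "- \<alpha>1 < F t - U1 t \<and> F t - U2 t < \<alpha>2" if t: "t \<in> {x0 - \<delta>..x0 + \<delta>}" for t
  proof -
    have t1: "t \<in> {0..1}" using t \<delta> by auto
    have "\<bar>F t - U1 t\<bar> \<le> \<alpha>1" "\<bar>F t - U2 t\<bar> \<le> \<alpha>2"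
      using taut t1 by (auto simp: taut_string_def)
    moreover have "\<alpha>2 - \<alpha>1 < U2 t - U1 t" 
    proof -
      have "\<bar>t - x0\<bar> < d" using t \<delta> by auto
      then show ?thesis using d(2)[OF t1] unfolding D_def by linarith
    qed
    ultimately show ?thesis using le by (auto simp: abs_le_iff)
  qed
  have "(U2 x0 - U2 (x0 - \<delta>)) / (x0 - (x0 - \<delta>)) \<le> (U2 (x0 + \<delta>) - U2 x0) / ((x0 + \<delta>) - x0)"
    by (rule taut_string_convex[OF taut(2)]) (use \<delta> W in auto)
  moreover have "(U1 (x0 + \<delta>) - U1 x0) / ((x0 + \<delta>) - x0) \<le> (U1 x0 - U1 (x0 - \<delta>)) / (x0 - (x0 - \<delta>))"
    by (rule taut_string_concave[OF taut(1)]) (use \<delta> W in auto)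
  ultimately have "D x0 - D (x0 - \<delta>) \<le> D (x0 + \<delta>) - D x0"
    using \<delta> by (simp add: divide_le_cancel D_def)
  moreover have "D (x0 + \<delta>) \<le> D x0" "D (x0 - \<delta>) \<le> D x0" using xm(2) x0' \<delta> by auto
  ultimately have "D (x0 - \<delta>) = D xm" using x0' by auto
  then have "x0 - \<delta> \<in> S" using \<delta> x01 by (auto simp: S_def)
  then show False using x0(2) \<delta> by force
qed

text \<open>
  At an upward jump of the slope of \<open>U2\<close> the bound of \<open>taut_string_comparison\<close> is attained, since \<open>U2\<close>
  lies at distance \<open>\<alpha>2\<close> above \<open>F\<close> and \<open>U1\<close> at most \<open>\<alpha>1\<close> above it. So \<open>U2 - U1\<close> has a maximum there,
  and its one-sided derivatives have the corresponding signs.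
\<close>
lemma taut_string_jump_comparison:
  assumes taut: "taut_string \<alpha>1 F U1" "taut_string \<alpha>2 F U2" and le: "\<alpha>1 \<le> \<alpha>2" and x: "0 < x" "x < 1"
    and U2: "left_slope U2 x l2" "right_slope U2 x r2" and lr: "l2 < r2"
    and U1: "left_slope U1 x l1" "right_slope U1 x r1"
  shows "l1 \<le> l2" "r2 \<le> r1"
proof -
  have W: "F x - U2 x = - \<alpha>2" by (rule taut_string_up_jump[OF taut(2) x U2 lr])
  have "\<bar>F x - U1 x\<bar> \<le> \<alpha>1" using taut(1) x by (auto simp: taut_string_def)
  then have "\<alpha>2 - \<alpha>1 \<le> U2 x - U1 x" using W by linarith
  then have "U2 t - U1 t \<le> U2 x - U1 x" if "t \<in> {0..1}" for t
    using taut_string_comparison[OF taut le that] by linarith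
  from slopes_at_max[OF slope_diff(1)[OF U2(1) U1(1)] slope_diff(2)[OF U2(2) U1(2)] x this]
  show "l1 \<le> l2" "r2 \<le> r1" by auto
qed

section \<open>Taut strings as primitives of functions of bounded variation\<close>
text \<open>
  The Jordan decomposition of the derivative of \<open>U\<close> on \<open>[a, b]\<close>. The two monotone functions are
  defined and right-continuous on the whole line, so that each of them generates a Stieltjes measure.
\<close>
definition BV_primitive :: "(real \<Rightarrow> real) \<Rightarrow> real \<Rightarrow> real \<Rightarrow> (real \<Rightarrow> real) \<Rightarrow> (real \<Rightarrow> real) \<Rightarrow> bool" where
  "BV_primitive U a b g1 g2 \<longleftrightarrow>
     mono g1 \<and> mono g2 \<and> (\<forall>x. continuous (at_right x) g1) \<and> (\<forall>x. continuous (at_right x) g2) \<and>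
     (\<forall>x y. a \<le> x \<and> x \<le> y \<and> y \<le> b \<longrightarrow> ((\<lambda>t. g1 t - g2 t) has_integral (U y - U x)) {x..y})"

lemma BV_primitive_uminus:
  assumes "BV_primitive (\<lambda>x. - U x) a b g1 g2"
  shows "BV_primitive U a b g2 g1"
  unfolding BV_primitive_def
proof (intro conjI allI impI)
  fix x y assume "a \<le> x \<and> x \<le> y \<and> y \<le> b"
  then have "((\<lambda>t. g1 t - g2 t) has_integral (- U y - - U x)) {x..y}"
    using assms by (simp add: BV_primitive_def)
  from has_integral_neg[OF this] show "((\<lambda>t. g2 t - g1 t) has_integral (U y - U x)) {x..y}"
    by simp
qed (use assms in \<open>auto simp: BV_primitive_def\<close>)

lemma BV_primitive_affine:
  assumes "\<And>y. y \<in> {a..b} \<Longrightarrow> U y = U a + c * (y - a)"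
  shows "BV_primitive U a b (\<lambda>_. c) (\<lambda>_. 0)"
  unfolding BV_primitive_def
proof (intro conjI allI impI)
  fix x y assume xy: "a \<le> x \<and> x \<le> y \<and> y \<le> b"
  have "U y - U x = c * (y - x)" using assms[of x] assms[of y] xy by (simp add: algebra_simps)
  then show "((\<lambda>t. c - 0) has_integral (U y - U x)) {x..y}"
    using has_integral_const_real[of c x y] xy by (simp add: mult.commute)
qed (auto simp: mono_def)

text \<open>
  Raising both functions of the right-hand piece by the same constant leaves their difference
  unchanged, and a large constant makes the glued functions monotone.
\<close>
lemma BV_primitive_combine:
  assumes 1: "BV_primitive U a b g1 g2" and 2: "BV_primitive U b c k1 k2" and ab: "a \<le> b" and bc: "b \<le> c"
  shows "\<exists>h1 h2. BV_primitive U a c h1 h2"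
proof -
  define C where "C = max (g1 b - k1 b) (g2 b - k2 b)"
  define glue where "glue = (\<lambda>(g::real \<Rightarrow> real) k x. if x < b then g x else k x + C)"
  have mono_glue: "mono (glue g k)" if m: "mono g" "mono k" "g b - k b \<le> C" for g k
  proof (rule monoI)
    fix x y :: real assume xy: "x \<le> y"
    show "glue g k x \<le> glue g k y"
    proof (cases "x < b \<and> \<not> y < b")
      case True
      have "g x \<le> g b" using m True by (auto intro: monoD)
      also have "\<dots> \<le> k b + C" using m by simp
      also have "\<dots> \<le> k y + C" using m True by (auto intro: monoD)
      finally show ?thesis using True by (simp add: glue_def)
    next
      case False
      then show ?thesis using m xy by (auto simp: glue_def intro: monoD)
    qed
  qed
  have cont_glue: "continuous (at_right x) (glue g k)"
    if "\<forall>x. continuous (at_right x) g" "\<forall>x. continuous (at_right x) k" for g k x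
  proof (cases "x < b")
    case True
    have "(g \<longlongrightarrow> g x) (at_right x)" using that(1) by (simp add: continuous_within)
    moreover have "\<forall>\<^sub>F y in at_right x. g y = glue g k y"
      by (rule eventually_at_rightI[of _ b]) (use True in \<open>auto simp: glue_def\<close>)
    ultimately have "(glue g k \<longlongrightarrow> g x) (at_right x)" by (rule Lim_transform_eventually)
    then show ?thesis using True by (simp add: continuous_within glue_def)
  next
    case False
    have "((\<lambda>y. k y + C) \<longlongrightarrow> k x + C) (at_right x)" using that(2) by (intro tendsto_intros) (simp add: continuous_within)
    moreover have "\<forall>\<^sub>F y in at_right x. k y + C = glue g k y"
      by (rule eventually_at_rightI[of _ "x + 1"]) (use False in \<open>auto simp: glue_def\<close>)
    ultimately have "(glue g k \<longlongrightarrow> k x + C) (at_right x)" by (rule Lim_transform_eventually)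
    then show ?thesis using False by (simp add: continuous_within glue_def)
  qed
  \<comment> \<open>At \<open>b\<close> the glued functions take the values of the right-hand piece; this changes the integrand
    of the left-hand piece at a single point only.\<close>
  have intl: "((\<lambda>t. glue g1 k1 t - glue g2 k2 t) has_integral (U y - U x)) {x..y}" if "a \<le> x" "x \<le> y" "y \<le> b" for x y
  proof -
    have "((\<lambda>t. g1 t - g2 t) has_integral (U y - U x)) {x..y}"
      using 1 that by (simp add: BV_primitive_def)
    then show ?thesis
      by (rule has_integral_spike[of "{b}", rotated 2]) (use that in \<open>auto simp: glue_def\<close>)
  qed
  have intr: "((\<lambda>t. glue g1 k1 t - glue g2 k2 t) has_integral (U y - U x)) {x..y}" if "b \<le> x" "x \<le> y" "y \<le> c" for x y
  proof -
    have "((\<lambda>t. k1 t - k2 t) has_integral (U y - U x)) {x..y}"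
      using 2 that by (simp add: BV_primitive_def)
    then show ?thesis
      by (rule has_integral_eq[rotated]) (use that in \<open>auto simp: glue_def\<close>)
  qed
  have "((\<lambda>t. glue g1 k1 t - glue g2 k2 t) has_integral (U y - U x)) {x..y}"
    if xy: "a \<le> x" "x \<le> y" "y \<le> c" for x y
  proof -
    consider "y \<le> b" | "b \<le> x" | "x \<le> b" "b \<le> y" by linarith
    then show ?thesis
    proof cases
      case 3
      then show ?thesis
        using has_integral_combine[OF 3 intl[of x b] intr[of b y]] xy by simp
    qed (use intl intr xy in auto)
  qed
  then have "BV_primitive U a c (glue g1 k1) (glue g2 k2)"
    unfolding BV_primitive_def
    using 1 2 mono_glue[of g1 k1] mono_glue[of g2 k2] cont_glue
    by (auto simp: BV_primitive_def C_def)
  then show ?thesis by blast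
qed

text \<open>
  Bisecting an interval halves the total bound, because the increments of \<open>v\<close> add up while the lengths
  are halved.
\<close>
lemma increment_zero_of_superadditive_bound:
  fixes G v :: "real \<Rightarrow> real"
  assumes "a \<le> b" and le: "\<And>x y. a \<le> x \<Longrightarrow> x \<le> y \<Longrightarrow> y \<le> b \<Longrightarrow> \<bar>G y - G x\<bar> \<le> (v y - v x) * (y - x)"
  shows "G b = G a"
proof -
  have *: "\<bar>G y - G x\<bar> \<le> (v y - v x) * (y - x) / 2 ^ n" if "a \<le> x" "x \<le> y" "y \<le> b" for x y n
    using that
  proof (induction n arbitrary: x y)
    case 0
    then show ?case using le by simp
  next
    case (Suc n)
    define m where "m = (x + y) / 2"
    have m: "a \<le> m" "x \<le> m" "m \<le> y" "m \<le> b" "m - x = (y - x) / 2" "y - m = (y - x) / 2"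
      using Suc.prems by (auto simp: m_def field_simps)
    have "\<bar>G y - G x\<bar> \<le> \<bar>G m - G x\<bar> + \<bar>G y - G m\<bar>" by linarith
    also have "\<dots> \<le> (v m - v x) * (m - x) / 2 ^ n + (v y - v m) * (y - m) / 2 ^ n"
    proof (rule add_mono)
      show "\<bar>G m - G x\<bar> \<le> (v m - v x) * (m - x) / 2 ^ n"
        by (rule Suc.IH) (use Suc.prems(1) m(2,4) in simp_all)
      show "\<bar>G y - G m\<bar> \<le> (v y - v m) * (y - m) / 2 ^ n"
        by (rule Suc.IH) (use Suc.prems(3) m(1,3) in simp_all)
    qed
    also have "\<dots> = (v y - v x) * (y - x) / 2 ^ Suc n"
      unfolding m(5,6) by (simp add: field_simps)
    finally show ?case .
  qed
  have "(\<lambda>n. (v b - v a) * (b - a) * (1 / 2) ^ n) \<longlonglongrightarrow> (v b - v a) * (b - a) * 0"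
    by (intro tendsto_intros LIMSEQ_realpow_zero) auto
  then have "\<bar>G b - G a\<bar> \<le> 0"
    using *[of a b] assms(1)
    by (intro LIMSEQ_le_const[of "\<lambda>n. (v b - v a) * (b - a) * (1 / 2) ^ n"])
       (auto simp: power_divide)
  then show ?thesis by simp
qed

lemma mono_absolutely_integrable:
  fixes g :: "real \<Rightarrow> real"
  assumes "mono g"
  shows "g absolutely_integrable_on {x..y}"
proof (rule measurable_bounded_by_integrable_imp_absolutely_integrable)
  have "g \<in> borel_measurable borel" using assms by (rule borel_measurable_mono)
  then have "g \<in> borel_measurable lebesgue" by (intro measurable_completion) simp
  then show "g \<in> borel_measurable (lebesgue_on {x..y})" by (rule measurable_restrict_space1)
  show "norm (g t) \<le> \<bar>g x\<bar> + \<bar>g y\<bar>" if "t \<in> {x..y}" for t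
    using monoD[OF assms, of x t] monoD[OF assms, of t y] that by auto
qed auto

text \<open>
  The right derivative \<open>v\<close> of a convex function, as the infimum of the slopes to the right, is monotone
  and right-continuous. The increment of \<open>U\<close> over \<open>[x, y]\<close> and the integral of \<open>v\<close> both lie between
  \<open>v x * (y - x)\<close> and \<open>v y * (y - x)\<close>, so they agree by \<open>increment_zero_of_superadditive_bound\<close>.
  Staying away from the end points of the open interval keeps \<open>v\<close> bounded.
\<close>
lemma convex_BV_primitive:
  assumes cont: "continuous_on {a<..<b} U"
    and conv: "\<And>x y z. a < x \<Longrightarrow> x < y \<Longrightarrow> y < z \<Longrightarrow> z < b \<Longrightarrow> (U y - U x) / (y - x) \<le> (U z - U y) / (z - y)"
    and pq: "a < p" "p \<le> q" "q < b"
  shows "\<exists>g. BV_primitive U p q g (\<lambda>_. 0)"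
proof -
  define v where "v = (\<lambda>x. Inf ((\<lambda>y. (U y - U x) / (y - x)) ` {x<..<b}))"
  have bdd: "bdd_below ((\<lambda>y. (U y - U x) / (y - x)) ` {x<..<b})" if "a < x" "x < b" for x
  proof (rule bdd_belowI)
    fix s assume "s \<in> (\<lambda>y. (U y - U x) / (y - x)) ` {x<..<b}"
    then show "(U x - U ((a + x) / 2)) / (x - (a + x) / 2) \<le> s"
      using conv[of "(a + x) / 2" x] that by auto
  qed
  have v_le: "v x \<le> (U y - U x) / (y - x)" if "a < x" "x < y" "y < b" for x y
    unfolding v_def by (rule cInf_lower) (use that bdd in auto)
  have le_v: "(U y - U x) / (y - x) \<le> v y" if "a < x" "x < y" "y < b" for x y
    unfolding v_def by (rule cInf_greatest) (use that conv in auto)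
  have v_mono: "v x \<le> v y" if "a < x" "x \<le> y" "y < b" for x y
    using v_le[of x y] le_v[of x y] that by (cases "x = y") auto
  have v_right: "(v \<longlongrightarrow> v x) (at_right x)" if x: "a < x" "x < b" for x
  proof (rule order_tendstoI)
    fix e assume e: "e < v x"
    show "\<forall>\<^sub>F y in at_right x. e < v y"
    proof (rule eventually_at_rightI[of x b])
      show "e < v y" if "y \<in> {x<..<b}" for y using e v_mono[of x y] x that by simp
    qed (use x in simp)
  next
    fix e assume e: "v x < e"
    have "\<exists>s\<in>(\<lambda>y. (U y - U x) / (y - x)) ` {x<..<b}. s < e"
      using e cInf_lessD[of "(\<lambda>y. (U y - U x) / (y - x)) ` {x<..<b}" e] x unfolding v_def by auto
    then obtain z where z: "x < z" "z < b" "(U z - U x) / (z - x) < e" by auto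
    have "(U \<longlongrightarrow> U x) (at_right x)"
    proof -
      have "isCont U x" using cont x by (auto intro: continuous_on_interior)
      then show ?thesis unfolding isCont_def by (rule tendsto_mono[rotated]) (simp add: at_le)
    qed
    then have "((\<lambda>y. (U z - U y) / (z - y)) \<longlongrightarrow> (U z - U x) / (z - x)) (at_right x)"
      using z by (intro tendsto_intros) auto
    then have "\<forall>\<^sub>F y in at_right x. (U z - U y) / (z - y) < e"
      using z(3) by (rule order_tendstoD(2))
    moreover have "\<forall>\<^sub>F y in at_right x. v y \<le> (U z - U y) / (z - y)"
      by (rule eventually_at_rightI[of _ z]) (use v_le z x in auto)
    ultimately show "\<forall>\<^sub>F y in at_right x. v y < e" by eventually_elim simp
  qed
  define g where "g = (\<lambda>x. v (max p (min q x)))"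
  have g_mono: "mono g" unfolding g_def by (rule monoI, rule v_mono) (use pq in auto)
  have g_eq: "g x = v x" if "p \<le> x" "x \<le> q" for x using that by (simp add: g_def)
  have g_right: "continuous (at_right x) g" for x
  proof -
    consider "x < p" | "p \<le> x" "x < q" | "q \<le> x" by linarith
    then have "(g \<longlongrightarrow> g x) (at_right x)"
    proof cases
      case 1
      then have "\<forall>\<^sub>F y in at_right x. g y = g x"
        by (intro eventually_at_rightI[of _ p]) (auto simp: g_def)
      then show ?thesis by (rule tendsto_eventually)
    next
      case 2
      have "\<forall>\<^sub>F y in at_right x. v y = g y"
        by (rule eventually_at_rightI[of _ q]) (use 2 g_eq in auto)
      then show ?thesis using v_right[of x] 2 pq g_eq[of x] by (auto intro: Lim_transform_eventually)
    next
      case 3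
      then have "\<forall>\<^sub>F y in at_right x. g y = g x"
        by (intro eventually_at_rightI[of _ "x+1"]) (auto simp: g_def)
      then show ?thesis by (rule tendsto_eventually)
    qed
    then show ?thesis by (simp add: continuous_within)
  qed
  have g_int: "g integrable_on {x..y}" for x y
    using mono_absolutely_integrable[OF g_mono] by (rule set_lebesgue_integral_eq_integral(1))
  have sandwich: "g x * (y - x) \<le> U y - U x \<and> U y - U x \<le> g y * (y - x)" if "p \<le> x" "x \<le> y" "y \<le> q" for x y
  proof (cases "x = y")
    case False
    then show ?thesis using v_le[of x y] le_v[of x y] that pq g_eq by (simp add: field_simps)
  qed simp
  define G where "G = (\<lambda>x. U x - integral {p..x} g)"
  have G: "\<bar>G y - G x\<bar> \<le> (g y - g x) * (y - x)" if xy: "p \<le> x" "x \<le> y" "y \<le> q" for x y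
  proof -
    have "integral {p..y} g = integral {p..x} g + integral {x..y} g"
      using Henstock_Kurzweil_Integration.integral_combine[OF xy(1,2) g_int] by simp
    moreover have "g x * (y - x) \<le> integral {x..y} g"
    proof -
      have "integral {x..y} (\<lambda>_. g x) \<le> integral {x..y} g"
        by (rule integral_le) (use g_int monoD[OF g_mono] in auto)
      then show ?thesis using xy by (simp add: mult.commute)
    qed
    moreover have "integral {x..y} g \<le> g y * (y - x)"
    proof -
      have "integral {x..y} g \<le> integral {x..y} (\<lambda>_. g y)"
        by (rule integral_le) (use g_int monoD[OF g_mono] in auto)
      then show ?thesis using xy by (simp add: mult.commute)
    qed
    ultimately show ?thesis using sandwich[OF xy] unfolding G_def left_diff_distrib by linarith
  qed
  have "(g has_integral (U y - U x)) {x..y}" if xy: "p \<le> x" "x \<le> y" "y \<le> q" for x y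
  proof -
    have "G y = G x" by (rule increment_zero_of_superadditive_bound[OF xy(2), of G g]) (use G xy in auto)
    moreover have "integral {p..y} g = integral {p..x} g + integral {x..y} g"
      using Henstock_Kurzweil_Integration.integral_combine[OF xy(1,2) g_int] by simp
    ultimately have "integral {x..y} g = U y - U x" by (simp add: G_def)
    then show ?thesis using g_int[of x y] by (metis integrable_integral)
  qed
  then have "BV_primitive U p q g (\<lambda>_. 0)"
    unfolding BV_primitive_def using g_mono g_right by (auto simp: mono_def)
  then show ?thesis by blast
qed

lemma affine_of_equal_slopes:
  fixes U :: "real \<Rightarrow> real"
  assumes ab: "a < b" and eq: "\<And>y. a < y \<Longrightarrow> y < b \<Longrightarrow> (U y - U a) / (y - a) = (U b - U y) / (b - y)"
  shows "\<exists>c. \<forall>y\<in>{a..b}. U y = U a + c * (y - a)"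
proof (intro exI ballI)
  fix y assume y: "y \<in> {a..b}"
  show "U y = U a + ((U b - U a) / (b - a)) * (y - a)"
  proof (cases "y = a \<or> y = b")
    case True
    then show ?thesis using ab by auto
  next
    case False
    then have y: "a < y" "y < b" using y by auto
    then have "(U y - U a) * (b - y) = (U b - U y) * (y - a)" using eq[OF y] by (simp add: frac_eq_eq)
    then have "(U y - U a) * (b - a) = (U b - U a) * (y - a)" by (simp add: algebra_simps)
    then show ?thesis using ab by (simp add: field_simps)
  qed
qed

text \<open>
  Since the two boundaries of the tube are \<open>2 * \<alpha>\<close> apart, the string is near every point off at least
  one of them, hence convex or concave. Near \<open>0\<close> and \<open>1\<close> it is off both, hence affine; this covers the
  end points, where a convex function could have an infinite slope.
\<close>
lemma taut_string_BV_primitive_local: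
  assumes taut: "taut_string \<alpha> F U" and \<alpha>: "0 < \<alpha>" and x: "x \<in> {0..1}"
  shows "\<exists>d>0. \<forall>a b. a \<le> x \<and> x \<le> b \<and> b - a < d \<longrightarrow> 0 \<le> a \<longrightarrow> b \<le> 1 \<longrightarrow> (\<exists>g1 g2. BV_primitive U a b g1 g2)"
proof -
  have contU: "continuous_on {0..1} U" using taut by (simp add: taut_string_def)
  have "continuous_on {0..1} (\<lambda>t. F t - U t)" using taut by (auto simp: taut_string_def intro!: continuous_intros)
  then obtain d where d: "0 < d" "\<And>t. t \<in> {0..1} \<Longrightarrow> \<bar>t - x\<bar> < d \<Longrightarrow> \<bar>(F t - U t) - (F x - U x)\<bar> < \<alpha>"
    using unit_interval_modulus[of "\<lambda>t. F t - U t" x \<alpha>] x \<alpha> by auto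
  show ?thesis
  proof (cases "x = 0 \<or> x = 1")
    case True
    then have W0: "F x - U x = 0" using taut by (auto simp: taut_string_def)
    have "\<exists>g1 g2. BV_primitive U a b g1 g2" if ab: "a \<le> x" "x \<le> b" "b - a < d" "0 \<le> a" "b \<le> 1" for a b
    proof (cases "a = b")
      case True
      then have "BV_primitive U a b (\<lambda>_. 0) (\<lambda>_. 0)" by (intro BV_primitive_affine) auto
      then show ?thesis by blast
    next
      case False
      have W: "\<bar>F t - U t\<bar> < \<alpha>" if "t \<in> {a..b}" for t using d(2)[of t] that ab W0 by auto
      have eq: "(U y - U a) / (y - a) = (U b - U y) / (b - y)" if "a < y" "y < b" for y
      proof (rule antisym)
        have "F t - U t < \<alpha> \<and> - \<alpha> < F t - U t" if "t \<in> {a..b}" for t using W[OF that] by linarith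
        then have "\<forall>t\<in>{a..b}. F t - U t < \<alpha>" "\<forall>t\<in>{a..b}. - \<alpha> < F t - U t" by simp_all
        then show "(U y - U a) / (y - a) \<le> (U b - U y) / (b - y)" "(U b - U y) / (b - y) \<le> (U y - U a) / (y - a)"
          using taut that ab unfolding taut_string_def by blast+
      qed
      have "a < b" using False ab by simp
      then have "\<exists>c. \<forall>y\<in>{a..b}. U y = U a + c * (y - a)"
        by (rule affine_of_equal_slopes[of a b U]) (rule eq)
      then obtain c where "\<forall>y\<in>{a..b}. U y = U a + c * (y - a)" by blast
      then have "BV_primitive U a b (\<lambda>_. c) (\<lambda>_. 0)" by (blast intro: BV_primitive_affine)
      then show ?thesis by blast
    qed
    then show ?thesis using d(1) by blast
  next
    case False
    define \<delta> where "\<delta> = min d (min x (1 - x))"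
    have \<delta>: "0 < \<delta>" "\<delta> \<le> d" "\<delta> \<le> x" "\<delta> \<le> 1 - x" using d False x by (auto simp: \<delta>_def)
    have "\<exists>g1 g2. BV_primitive U a b g1 g2" if ab: "a \<le> x" "x \<le> b" "b - a < \<delta>" for a b
    proof -
      have ab': "x - \<delta> < a" "a \<le> b" "b < x + \<delta>" using ab by auto
      have c: "continuous_on {x - \<delta><..<x + \<delta>} U" using \<delta> by (intro continuous_on_subset[OF contU]) auto
      have W: "\<bar>(F t - U t) - (F x - U x)\<bar> < \<alpha>" if "t \<in> {x - \<delta><..<x + \<delta>}" for t
        using d(2)[of t] that \<delta> by auto
      show ?thesis
      proof (cases "F x - U x \<le> 0")
        case True
        have "F t - U t < \<alpha>" if "t \<in> {x - \<delta><..<x + \<delta>}" for t using W[OF that] True by linarith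
        then have "(U y - U u) / (y - u) \<le> (U z - U y) / (z - y)"
          if "x - \<delta> < u" "u < y" "y < z" "z < x + \<delta>" for u y z
          using taut that \<delta> unfolding taut_string_def by auto
        then show ?thesis using convex_BV_primitive[OF c _ ab'] by blast
      next
        case False
        have "- \<alpha> < F t - U t" if "t \<in> {x - \<delta><..<x + \<delta>}" for t using W[OF that] False by linarith
        then have cc: "(U z - U y) / (z - y) \<le> (U y - U u) / (y - u)"
          if "x - \<delta> < u" "u < y" "y < z" "z < x + \<delta>" for u y z
          using taut that \<delta> unfolding taut_string_def by auto
        have "\<exists>g. BV_primitive (\<lambda>t. - U t) a b g (\<lambda>_. 0)"
        proof (rule convex_BV_primitive[OF _ _ ab'])
          show "continuous_on {x - \<delta><..<x + \<delta>} (\<lambda>t. - U t)" by (intro continuous_intros c)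
          have *: "(- U y - - U u) / (y - u) = - ((U y - U u) / (y - u))" for u y
            by (metis minus_diff_minus minus_divide_left)
          show "(- U y - - U u) / (y - u) \<le> (- U z - - U y) / (z - y)"
            if "x - \<delta> < u" "u < y" "y < z" "z < x + \<delta>" for u y z
            unfolding * using cc[OF that] by simp
        qed
        then show ?thesis using BV_primitive_uminus by blast
      qed
    qed
    then show ?thesis using \<delta>(1) by blast
  qed
qed

lemma taut_string_BV_primitive:
  assumes taut: "taut_string \<alpha> F U" and \<alpha>: "0 < \<alpha>"
  shows "\<exists>g1 g2. BV_primitive U 0 1 g1 g2"
proof -
  have "0 \<le> (0::real) \<longrightarrow> 1 \<le> (1::real) \<longrightarrow> (\<exists>g1 g2. BV_primitive U 0 1 g1 g2)"
  proof (rule Bolzano[where P = "\<lambda>a b. 0 \<le> a \<longrightarrow> b \<le> 1 \<longrightarrow> (\<exists>g1 g2. BV_primitive U a b g1 g2)"])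
    fix a b c :: real
    assume "0 \<le> a \<longrightarrow> b \<le> 1 \<longrightarrow> (\<exists>g1 g2. BV_primitive U a b g1 g2)"
      "0 \<le> b \<longrightarrow> c \<le> 1 \<longrightarrow> (\<exists>g1 g2. BV_primitive U b c g1 g2)" "a \<le> b" "b \<le> c"
    then show "0 \<le> a \<longrightarrow> c \<le> 1 \<longrightarrow> (\<exists>g1 g2. BV_primitive U a c g1 g2)"
      using BV_primitive_combine[of U a b _ _ c] by (meson order_trans)
  next
    fix x :: real assume "0 \<le> x" "x \<le> 1"
    then show "\<exists>d>0. \<forall>a b. a \<le> x \<and> x \<le> b \<and> b - a < d \<longrightarrow> 0 \<le> a \<longrightarrow> b \<le> 1 \<longrightarrow> (\<exists>g1 g2. BV_primitive U a b g1 g2)"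
      using taut_string_BV_primitive_local[OF taut \<alpha>, of x] by simp
  qed simp
  then show ?thesis by simp
qed

section \<open>Approximate limits and the distributional derivative\<close>
lemma left_approx_lim_iff:
  assumes u: "u absolutely_integrable_on {0..1}" and x: "0 < x" "x < 1"
  shows "left_approx_lim u x l \<longleftrightarrow> left_slope (\<lambda>x. integral {0..x} u) x l"
  unfolding left_approx_lim_def left_slope_def
proof (rule tendsto_cong)
  have int: "u integrable_on {0..1}" using u by (rule set_lebesgue_integral_eq_integral(1))
  have "1 / (x - y) * (LINT t:{y..x}|lebesgue. u t) = (integral {0..x} u - integral {0..y} u) / (x - y)"
    if y: "y \<in> {0<..<x}" for y
  proof -
    have "u absolutely_integrable_on {y..x}"
      by (rule absolutely_integrable_on_subinterval[OF u]) (use x y in auto)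
    then have "(LINT t:{y..x}|lebesgue. u t) = integral {y..x} u"
      by (rule set_lebesgue_integral_eq_integral(2))
    moreover have "integral {0..y} u + integral {y..x} u = integral {0..x} u"
      by (rule Henstock_Kurzweil_Integration.integral_combine)
         (use x y in \<open>auto intro!: integrable_on_subinterval[OF int]\<close>)
    ultimately show ?thesis by simp
  qed
  then show "\<forall>\<^sub>F y in at_left x. 1 / (x - y) * (LINT t:{y..x}|lebesgue. u t) = (integral {0..x} u - integral {0..y} u) / (x - y)"
    by (intro eventually_at_leftI[of 0]) (use x in auto)
qed

lemma right_approx_lim_iff:
  assumes u: "u absolutely_integrable_on {0..1}" and x: "0 < x" "x < 1"
  shows "right_approx_lim u x r \<longleftrightarrow> right_slope (\<lambda>x. integral {0..x} u) x r"
  unfolding right_approx_lim_def right_slope_def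
proof (rule tendsto_cong)
  have int: "u integrable_on {0..1}" using u by (rule set_lebesgue_integral_eq_integral(1))
  have "1 / (y - x) * (LINT t:{x..y}|lebesgue. u t) = (integral {0..y} u - integral {0..x} u) / (y - x)"
    if y: "y \<in> {x<..<1}" for y
  proof -
    have "u absolutely_integrable_on {x..y}"
      by (rule absolutely_integrable_on_subinterval[OF u]) (use x y in auto)
    then have "(LINT t:{x..y}|lebesgue. u t) = integral {x..y} u"
      by (rule set_lebesgue_integral_eq_integral(2))
    moreover have "integral {0..x} u + integral {x..y} u = integral {0..y} u"
      by (rule Henstock_Kurzweil_Integration.integral_combine)
         (use x y in \<open>auto intro!: integrable_on_subinterval[OF int]\<close>)
    ultimately show ?thesis by simp
  qed
  then show "\<forall>\<^sub>F y in at_right x. 1 / (y - x) * (LINT t:{x..y}|lebesgue. u t) = (integral {0..y} u - integral {0..x} u) / (y - x)"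
    by (intro eventually_at_rightI[of _ 1]) (use x in auto)
qed

lemma mono_left_limit_exists:
  fixes g :: "real \<Rightarrow> real"
  assumes "mono g"
  shows "\<exists>L. (g \<longlongrightarrow> L) (at_left x)"
  using Lim_left_bound[of UNIV x g "g x"] monoD[OF assms] by auto

lemma left_slope_of_integral:
  assumes x: "0 < (x::real)" and int: "\<And>y. 0 \<le> y \<Longrightarrow> y \<le> x \<Longrightarrow> (v has_integral (U x - U y)) {y..x}"
    and lim: "(v \<longlongrightarrow> L) (at_left x)"
  shows "left_slope U x L"
  unfolding left_slope_def tendsto_iff
proof (intro allI impI)
  fix e :: real assume e: "0 < e"
  have "\<forall>\<^sub>F y in at_left x. dist (v y) L < e / 2" using tendstoD[OF lim, of "e / 2"] e by simp
  then obtain b where b: "b < x" "\<And>y. b < y \<Longrightarrow> y < x \<Longrightarrow> \<bar>v y - L\<bar> < e / 2"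
    unfolding eventually_at_left_field dist_real_def by blast
  have "dist ((U x - U y) / (x - y)) L < e" if y: "max 0 b < y" "y < x" for y
  proof -
    have "((\<lambda>t. v t - L) has_integral (U x - U y) - L * (x - y)) {y..x}"
      using has_integral_diff[OF int[of y] has_integral_const_real[of L y x]] y by (simp add: mult.commute)
    then have "norm ((U x - U y) - L * (x - y)) \<le> e / 2 * measure lborel {y..x}"
      by (rule has_integral_bound_real[where S = "{x}", rotated 2]) (use e b y in \<open>auto simp: less_imp_le\<close>)
    then have "\<bar>(U x - U y) - L * (x - y)\<bar> \<le> e / 2 * (x - y)" using y by simp
    then have "\<bar>((U x - U y) - L * (x - y)) / (x - y)\<bar> \<le> e / 2" using y by (simp add: abs_divide divide_le_eq)
    moreover have "((U x - U y) - L * (x - y)) / (x - y) = (U x - U y) / (x - y) - L"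
      using y by (simp add: diff_divide_distrib)
    ultimately show ?thesis using e by (simp add: dist_real_def)
  qed
  then show "\<forall>\<^sub>F y in at_left x. dist ((U x - U y) / (x - y)) L < e"
    by (intro eventually_at_leftI[of "max 0 b"]) (use b x in auto)
qed

lemma right_slope_of_integral:
  assumes x: "x < (1::real)" and int: "\<And>y. x \<le> y \<Longrightarrow> y \<le> 1 \<Longrightarrow> (v has_integral (U y - U x)) {x..y}"
    and lim: "(v \<longlongrightarrow> L) (at_right x)"
  shows "right_slope U x L"
  unfolding right_slope_def tendsto_iff
proof (intro allI impI)
  fix e :: real assume e: "0 < e"
  have "\<forall>\<^sub>F y in at_right x. dist (v y) L < e / 2" using tendstoD[OF lim, of "e / 2"] e by simp
  then obtain b where b: "x < b" "\<And>y. x < y \<Longrightarrow> y < b \<Longrightarrow> \<bar>v y - L\<bar> < e / 2"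
    unfolding eventually_at_right_field dist_real_def by blast
  have "dist ((U y - U x) / (y - x)) L < e" if y: "y < min 1 b" "x < y" for y
  proof -
    have "((\<lambda>t. v t - L) has_integral (U y - U x) - L * (y - x)) {x..y}"
      using has_integral_diff[OF int[of y] has_integral_const_real[of L x y]] y by (simp add: mult.commute)
    then have "norm ((U y - U x) - L * (y - x)) \<le> e / 2 * measure lborel {x..y}"
      by (rule has_integral_bound_real[where S = "{x}", rotated 2]) (use e b y in \<open>auto simp: less_imp_le\<close>)
    then have "\<bar>(U y - U x) - L * (y - x)\<bar> \<le> e / 2 * (y - x)" using y by simp
    then have "\<bar>((U y - U x) - L * (y - x)) / (y - x)\<bar> \<le> e / 2" using y by (simp add: abs_divide divide_le_eq)
    moreover have "((U y - U x) - L * (y - x)) / (y - x) = (U y - U x) / (y - x) - L"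
      using y by (simp add: diff_divide_distrib)
    ultimately show ?thesis using e by (simp add: dist_real_def)
  qed
  then show "\<forall>\<^sub>F y in at_right x. dist ((U y - U x) / (y - x)) L < e"
    by (intro eventually_at_rightI[of _ "min 1 b"]) (use b x in auto)
qed

text \<open>
  On a short interval \<open>h\<close> differs by less than \<open>e\<close> from a constant, and constants integrate to zero
  against \<open>w\<close>. So the integral of \<open>w * h\<close> over a short interval is at most \<open>e\<close> times that of \<open>\<bar>w\<bar>\<close>, and this
  bound adds up. It lets \<open>u\<close> be replaced by the derivative of its primitive in integrals against
  continuous functions.
\<close>
lemma integral_mult_continuous_zero:
  fixes w h :: "real \<Rightarrow> real"
  assumes w: "w absolutely_integrable_on {0..1}"
    and zero: "\<And>a b. 0 \<le> a \<Longrightarrow> a \<le> b \<Longrightarrow> b \<le> 1 \<Longrightarrow> integral {a..b} w = 0"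
    and h: "continuous_on {0..1} h"
  shows "integral {0..1} (\<lambda>t. w t * h t) = 0"
proof -
  note int = set_lebesgue_integral_eq_integral(1)
  have wh: "(\<lambda>t. w t * h t) absolutely_integrable_on {0..1}"
    by (rule absolutely_integrable_times_continuous[OF w h])
  have sub: "f integrable_on {a..b}" if "f absolutely_integrable_on {0..1}" "0 \<le> a" "b \<le> 1" for f :: "real \<Rightarrow> real" and a b
    using int[OF that(1)] by (rule integrable_on_subinterval) (use that in auto)
  have wabs: "(\<lambda>t. \<bar>w t\<bar>) absolutely_integrable_on {0..1}" by (intro set_integrable_abs w)
  have main: "\<bar>integral {0..1} (\<lambda>t. w t * h t)\<bar> \<le> e * integral {0..1} (\<lambda>t. \<bar>w t\<bar>)" if e: "0 < e" for e
  proof -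
    have "0 \<le> (0::real) \<longrightarrow> 1 \<le> (1::real) \<longrightarrow> \<bar>integral {0..1} (\<lambda>t. w t * h t)\<bar> \<le> e * integral {0..1} (\<lambda>t. \<bar>w t\<bar>)"
    proof (rule Bolzano[where P = "\<lambda>a b. 0 \<le> a \<longrightarrow> b \<le> 1 \<longrightarrow> \<bar>integral {a..b} (\<lambda>t. w t * h t)\<bar> \<le> e * integral {a..b} (\<lambda>t. \<bar>w t\<bar>)"])
      fix a b c :: real
      assume 1: "0 \<le> a \<longrightarrow> b \<le> 1 \<longrightarrow> \<bar>integral {a..b} (\<lambda>t. w t * h t)\<bar> \<le> e * integral {a..b} (\<lambda>t. \<bar>w t\<bar>)"
        and 2: "0 \<le> b \<longrightarrow> c \<le> 1 \<longrightarrow> \<bar>integral {b..c} (\<lambda>t. w t * h t)\<bar> \<le> e * integral {b..c} (\<lambda>t. \<bar>w t\<bar>)"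
        and ab: "a \<le> b" and bc: "b \<le> c"
      show "0 \<le> a \<longrightarrow> c \<le> 1 \<longrightarrow> \<bar>integral {a..c} (\<lambda>t. w t * h t)\<bar> \<le> e * integral {a..c} (\<lambda>t. \<bar>w t\<bar>)"
      proof (intro impI)
        assume ac: "0 \<le> a" "c \<le> 1"
        note cmb = Henstock_Kurzweil_Integration.integral_combine[OF ab bc, symmetric]
        show "\<bar>integral {a..c} (\<lambda>t. w t * h t)\<bar> \<le> e * integral {a..c} (\<lambda>t. \<bar>w t\<bar>)"
          unfolding cmb[OF sub[OF wh ac]] cmb[OF sub[OF wabs ac]]
          using 1 2 ac ab bc by (simp add: distrib_left)
      qed
    next
      fix x :: real assume x: "0 \<le> x" "x \<le> 1"
      obtain d where d: "0 < d" "\<And>t. t \<in> {0..1} \<Longrightarrow> \<bar>t - x\<bar> < d \<Longrightarrow> \<bar>h t - h x\<bar> < e"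
        using unit_interval_modulus[OF h _ e, of x] x by auto
      have "\<bar>integral {a..b} (\<lambda>t. w t * h t)\<bar> \<le> e * integral {a..b} (\<lambda>t. \<bar>w t\<bar>)"
        if ab: "a \<le> x" "x \<le> b" "b - a < d" "0 \<le> a" "b \<le> 1" for a b
      proof -
        have i1: "(\<lambda>t. w t * h t) integrable_on {a..b}" "w integrable_on {a..b}" "(\<lambda>t. \<bar>w t\<bar>) integrable_on {a..b}"
          using sub ab wh w wabs by auto
        have i2: "(\<lambda>t. h x * w t) integrable_on {a..b}" "(\<lambda>t. e * \<bar>w t\<bar>) integrable_on {a..b}"
          using integrable_on_mult_right[OF i1(2)] integrable_on_mult_right[OF i1(3)] by auto
        have "integral {a..b} (\<lambda>t. w t * h t - h x * w t) = integral {a..b} (\<lambda>t. w t * h t)"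
          using Henstock_Kurzweil_Integration.integral_diff[OF i1(1) i2(1)] zero[of a b] ab by simp
        moreover have "\<bar>integral {a..b} (\<lambda>t. w t * h t - h x * w t)\<bar> \<le> integral {a..b} (\<lambda>t. e * \<bar>w t\<bar>)"
        proof (rule integral_norm_bound_integral[OF integrable_diff[OF i1(1) i2(1)] i2(2), unfolded real_norm_def])
          fix t assume t: "t \<in> {a..b}"
          have "t \<in> {0..1}" "\<bar>t - x\<bar> < d" using t ab by auto
          then have "\<bar>h t - h x\<bar> \<le> e" using d(2)[of t] by simp
          then have "\<bar>w t\<bar> * \<bar>h t - h x\<bar> \<le> \<bar>w t\<bar> * e" by (rule mult_left_mono) simp
          then show "\<bar>w t * h t - h x * w t\<bar> \<le> e * \<bar>w t\<bar>"
            by (simp add: abs_mult[symmetric] algebra_simps)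
        qed
        ultimately show ?thesis by simp
      qed
      then show "\<exists>d>0. \<forall>a b. a \<le> x \<and> x \<le> b \<and> b - a < d \<longrightarrow> 0 \<le> a \<longrightarrow> b \<le> 1 \<longrightarrow>
          \<bar>integral {a..b} (\<lambda>t. w t * h t)\<bar> \<le> e * integral {a..b} (\<lambda>t. \<bar>w t\<bar>)"
        using d(1) by blast
    qed simp
    then show ?thesis by simp
  qed
  have "\<bar>integral {0..1} (\<lambda>t. w t * h t)\<bar> \<le> 0"
  proof (rule tendsto_lowerbound)
    show "((\<lambda>e. e * integral {0..1} (\<lambda>t. \<bar>w t\<bar>)) \<longlongrightarrow> 0) (at_right 0)"
      by (auto intro!: tendsto_eq_intros)
    show "\<forall>\<^sub>F e in at_right 0. \<bar>integral {0..1} (\<lambda>t. w t * h t)\<bar> \<le> e * integral {0..1} (\<lambda>t. \<bar>w t\<bar>)"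
      by (rule eventually_at_rightI[of 0 1]) (use main in auto)
  qed simp
  then show ?thesis by simp
qed

definition stieltjes :: "(real \<Rightarrow> real) \<Rightarrow> real measure" where
  "stieltjes g = restrict_space (interval_measure g) {0<..<1}"

lemma stieltjes_basic:
  assumes g: "mono g" "\<And>x. continuous (at_right x) g"
  shows "finite_measure (stieltjes g)" "sets (stieltjes g) = sets (restrict_space borel {0<..<1})"
    "0 < x \<Longrightarrow> x < 1 \<Longrightarrow> measure (stieltjes g) {0<..x} = g x - g 0"
proof -
  note m = monoD[OF g(1)]
  have "emeasure (interval_measure g) {0<..<1} \<le> emeasure (interval_measure g) {0<..1}"
    by (rule emeasure_mono) auto
  also have "\<dots> < \<infinity>" using emeasure_interval_measure_Ioc[of 0 1 g] m g(2) by simp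
  finally show "finite_measure (stieltjes g)" unfolding stieltjes_def
    by (intro finite_measureI) (auto simp: emeasure_restrict_space space_restrict_space)
  show "sets (stieltjes g) = sets (restrict_space borel {0<..<1})"
    unfolding stieltjes_def by (rule sets_restrict_space_cong) simp
  show "measure (stieltjes g) {0<..x} = g x - g 0" if "0 < x" "x < 1"
    using measure_interval_measure_Ioc[of 0 x g] m g(2) that
    unfolding stieltjes_def by (subst measure_restrict_space) auto
qed

text \<open>
  The interval without its right end point carries the left limit of \<open>g\<close>; the difference to
  \<open>stieltjes_basic(3)\<close> is the atom at \<open>x\<close>.
\<close>
lemma stieltjes_open:
  assumes g: "mono g" "\<And>x. continuous (at_right x) g" and x: "0 < x" "x < 1" and L: "(g \<longlongrightarrow> L) (at_left x)"
  shows "measure (stieltjes g) {0<..<x} = L - g 0"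
proof -
  interpret finite_measure "stieltjes g" by (rule stieltjes_basic(1)[OF g])
  define y where "y = (\<lambda>n. x - x / real (n + 2))"
  have y: "0 < y n" "y n < x" for n using x by (auto simp: y_def field_simps add_pos_nonneg)
  have ylim: "y \<longlonglongrightarrow> x"
  proof -
    have "(\<lambda>n. x - x / real (n + 2)) \<longlonglongrightarrow> x - 0"
      by (intro tendsto_diff tendsto_const LIMSEQ_ignore_initial_segment[OF lim_const_over_n[of x], of 2])
    then show ?thesis by (simp add: y_def)
  qed
  have inc: "incseq y" unfolding y_def
    by (rule incseq_SucI) (use x in \<open>auto simp: field_simps\<close>)
  have "(\<lambda>n. measure (stieltjes g) {0<..y n}) \<longlonglongrightarrow> measure (stieltjes g) (\<Union>n. {0<..y n})"
  proof (rule finite_Lim_measure_incseq)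
    show "incseq (\<lambda>n. {0<..y n})" using inc unfolding incseq_def by (force intro: order_trans)
    have "{0<..y n} \<inter> {0<..<1} = {0<..y n}" for n using y[of n] x by auto
    then show "range (\<lambda>n. {0<..y n}) \<subseteq> sets (stieltjes g)"
      unfolding stieltjes_basic(2)[OF g] sets_restrict_space by (auto intro!: image_eqI[of _ _ "{0<..y _}"])
  qed
  moreover have "(\<Union>n. {0<..y n}) = {0<..<x}"
  proof (intro equalityI subsetI)
    fix t assume "t \<in> (\<Union>n. {0<..y n})"
    then show "t \<in> {0<..<x}" using y by (auto intro: le_less_trans)
  next
    fix t assume t: "t \<in> {0<..<x}"
    then have "\<forall>\<^sub>F n in sequentially. t < y n" using order_tendstoD(1)[OF ylim, of t] by auto
    then obtain n where "t < y n" by (auto simp: eventually_sequentially)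
    then show "t \<in> (\<Union>n. {0<..y n})" using t by (auto intro!: exI[of _ n])
  qed
  moreover have "(\<lambda>n. measure (stieltjes g) {0<..y n}) \<longlonglongrightarrow> L - g 0"
  proof -
    have "filterlim y (at_left x) sequentially"
      using ylim y less_imp_neq[OF y(2)] by (auto simp: filterlim_at)
    then have "(\<lambda>n. g (y n) - g 0) \<longlonglongrightarrow> L - g 0"
      by (intro tendsto_intros filterlim_compose[OF L])
    moreover have "measure (stieltjes g) {0<..y n} = g (y n) - g 0" for n
      using stieltjes_basic(3)[OF g, of "y n"] y[of n] x by simp
    ultimately show ?thesis by simp
  qed
  ultimately show ?thesis using LIMSEQ_unique by fastforce
qed

text \<open>
  Insert \<open>\<psi>(x) = \<integral> \<psi>'(t) dt\<close> over \<open>0 < t < x\<close> and exchange the integrals: the inner one becomes the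
  measure of \<open>(t, 1)\<close>, which is a constant minus \<open>g t\<close>, and the constant integrates to zero against \<open>\<psi>'\<close>.
\<close>
lemma stieltjes_integration_by_parts:
  assumes g: "mono g" "\<And>x. continuous (at_right x) g" and \<psi>: "\<psi> \<in> C1c"
  shows "integral {0..1} (\<lambda>t. g t * deriv \<psi> t) = - (LINT x|stieltjes g. \<psi> x)"
proof -
  let ?I = "{0<..<1::real}" and ?M = "interval_measure g"
  interpret M: sigma_finite_measure ?M by (rule sigma_finite_interval_measure) (use g in \<open>auto dest: monoD\<close>)
  interpret pair_sigma_finite ?M lborel ..
  interpret S: finite_measure "stieltjes g" by (rule stieltjes_basic(1)[OF g])
  define D where "D = deriv \<psi>"
  have Dc: "continuous_on UNIV D" unfolding D_def by (rule C1c_deriv[OF \<psi>])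
  have Dm [measurable]: "D \<in> borel_measurable borel" using Dc by (rule borel_measurable_continuous_onI)
  have "bounded (D ` {0..1})"
    by (intro compact_imp_bounded compact_continuous_image continuous_on_subset[OF Dc]) auto
  then obtain B where B: "\<And>t. t \<in> {0..1} \<Longrightarrow> \<bar>D t\<bar> \<le> B"
    unfolding bounded_iff real_norm_def by blast
  have B0: "0 \<le> B" using B[of 0] by simp
  have finI: "emeasure ?M ?I < \<infinity>"
    using S.emeasure_finite[of ?I] by (simp add: stieltjes_def emeasure_restrict_space less_top)
  define \<phi> where "\<phi> = (\<lambda>x t. indicator ?I x * indicator ?I t * (if t < x then 1 else 0) * D t)"
  have phi: "integrable (?M \<Otimes>\<^sub>M lborel) (case_prod \<phi>)"
  proof (rule integrableI_bounded_set[where A = "?I \<times> ?I" and B = B])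
    show "case_prod \<phi> \<in> borel_measurable (?M \<Otimes>\<^sub>M lborel)"
      unfolding \<phi>_def by measurable
    show "?I \<times> ?I \<in> sets (?M \<Otimes>\<^sub>M lborel)" by (rule pair_measureI) auto
    have "emeasure (?M \<Otimes>\<^sub>M lborel) (?I \<times> ?I) = emeasure ?M ?I * emeasure lborel ?I"
      by (rule lborel.emeasure_pair_measure_Times) auto
    then show "emeasure (?M \<Otimes>\<^sub>M lborel) (?I \<times> ?I) < \<infinity>"
      using finI by (simp add: ennreal_mult_less_top)
    show "AE x in ?M \<Otimes>\<^sub>M lborel. x \<in> ?I \<times> ?I \<longrightarrow> norm (case_prod \<phi> x) \<le> B"
      by (rule AE_I2) (use B B0 in \<open>auto simp: \<phi>_def\<close>)
    show "AE x in ?M \<Otimes>\<^sub>M lborel. x \<notin> ?I \<times> ?I \<longrightarrow> case_prod \<phi> x = 0"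
      by (rule AE_I2) (auto simp: \<phi>_def indicator_def split: if_splits)
  qed
  have inner_t: "(LINT t|lborel. \<phi> x t) = indicator ?I x * \<psi> x" for x
  proof (cases "x \<in> ?I")
    case True
    have "(LINT t|lborel. \<phi> x t) = (LINT t|lborel. indicator {0<..<x} t *\<^sub>R D t)"
      by (intro Bochner_Integration.integral_cong) (use True in \<open>auto simp: \<phi>_def indicator_def\<close>)
    also have "\<dots> = (LINT t:{0..x}|lborel. D t)"
      unfolding set_lebesgue_integral_def
      by (rule integral_cong_AE) (use AE_lborel_singleton[of 0] AE_lborel_singleton[of x] in \<open>auto simp: indicator_def\<close>)
    also have "\<dots> = integral {0..x} D"
      by (rule set_borel_integral_eq_integral(2))
         (auto intro!: borel_integrable_atLeastAtMost' continuous_on_subset[OF Dc])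
    also have "\<dots> = \<psi> x"
      using C1c_deriv_integral[OF \<psi>, of x] True unfolding D_def by (auto intro: integral_unique)
    finally show ?thesis using True by simp
  qed (simp add: \<phi>_def)
  have inner_x: "(LINT x|?M. \<phi> x t) = indicator ?I t * ((measure (stieltjes g) ?I - (g t - g 0)) * D t)" for t
  proof (cases "t \<in> ?I")
    case True
    have "(LINT x|?M. \<phi> x t) = (LINT x|?M. indicator {t<..<1} x * D t)"
      by (intro Bochner_Integration.integral_cong) (use True in \<open>auto simp: \<phi>_def indicator_def\<close>)
    also have "\<dots> = measure ?M {t<..<1} * D t" by simp
    also have "measure ?M {t<..<1} = measure (stieltjes g) (?I - {0<..t})"
    proof -
      have "?I - {0<..t} = {t<..<1}" using True by auto
      then show ?thesis unfolding stieltjes_def by (subst measure_restrict_space) (use True in auto)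
    qed
    also have "\<dots> = measure (stieltjes g) ?I - measure (stieltjes g) {0<..t}"
    proof (rule S.finite_measure_Diff)
      show "?I \<in> sets (stieltjes g)" unfolding stieltjes_basic(2)[OF g] sets_restrict_space
        by (auto intro!: image_eqI[of _ _ ?I])
      have "{0<..t} = ?I \<inter> {0<..t}" using True by auto
      then show "{0<..t} \<in> sets (stieltjes g)" unfolding stieltjes_basic(2)[OF g] sets_restrict_space by auto
      show "{0<..t} \<subseteq> ?I" using True by auto
    qed
    also have "measure (stieltjes g) {0<..t} = g t - g 0" using stieltjes_basic(3)[OF g, of t] True by simp
    finally show ?thesis using True by simp
  qed (simp add: \<phi>_def)
  have "(LINT x|stieltjes g. \<psi> x) = (LINT x|?M. indicator ?I x *\<^sub>R \<psi> x)"
    unfolding stieltjes_def by (rule integral_restrict_space) simp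
  also have "\<dots> = (LINT x|?M. LINT t|lborel. \<phi> x t)" unfolding inner_t by simp
  also have "\<dots> = (LINT t|lborel. LINT x|?M. \<phi> x t)" by (rule Fubini_integral[OF phi, symmetric])
  also have "\<dots> = (LINT t:?I|lborel. (measure (stieltjes g) ?I - (g t - g 0)) * D t)"
    unfolding inner_x set_lebesgue_integral_def by simp
  also have "\<dots> = integral {0..1} (\<lambda>t. (measure (stieltjes g) ?I - (g t - g 0)) * D t)"
  proof -
    have gm: "g \<in> borel_measurable borel" using g(1) by (rule borel_measurable_mono)
    have "set_borel_measurable borel ?I (\<lambda>t. (measure (stieltjes g) ?I - (g t - g 0)) * D t)"
      unfolding set_borel_measurable_def using gm by measurable
    then have "(LINT t:?I|lborel. (measure (stieltjes g) ?I - (g t - g 0)) * D t)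
        = (LINT t:?I|lebesgue. (measure (stieltjes g) ?I - (g t - g 0)) * D t)"
      unfolding set_lebesgue_integral_def set_borel_measurable_def by (subst integral_completion) auto
    also have "\<dots> = integral {0..1} (\<lambda>t. (measure (stieltjes g) ?I - (g t - g 0)) * D t)"
      by (intro lebesgue_integral_unit absolutely_integrable_times_continuous set_integral_diff(1)
            mono_absolutely_integrable g absolutely_integrable_continuous_real continuous_on_const
            continuous_on_subset[OF Dc]) auto
    finally show ?thesis .
  qed
  also have "\<dots> = - integral {0..1} (\<lambda>t. g t * D t)"
  proof -
    define m where "m = measure (stieltjes g) ?I + g 0"
    have eq: "(\<lambda>t. (measure (stieltjes g) ?I - (g t - g 0)) * D t) = (\<lambda>t. m * D t - g t * D t)"
      by (auto simp: m_def algebra_simps)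
    have 1: "((\<lambda>t. m * D t) has_integral m * 0) {0..1}"
      using has_integral_mult_right[OF C1c_deriv_integral[OF \<psi>, of 1]] C1c_deriv(3)[OF \<psi>, of 1]
      by (simp add: D_def)
    have "(\<lambda>t. g t * D t) integrable_on {0..1}"
      by (intro set_lebesgue_integral_eq_integral(1) absolutely_integrable_times_continuous
            mono_absolutely_integrable g continuous_on_subset[OF Dc]) auto
    from has_integral_diff[OF 1 integrable_integral[OF this]]
    show ?thesis unfolding eq by (simp add: integral_unique)
  qed
  finally show ?thesis by (simp add: D_def)
qed

lemma square_pos_part_has_derivative:
  "((\<lambda>x::real. (max 0 x)\<^sup>2) has_real_derivative 2 * max 0 x) (at x)"
proof -
  consider "x < 0" | "x = 0" | "0 < x" by linarith
  then show ?thesis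
  proof cases
    case 1
    have "((\<lambda>x. 0) has_real_derivative 2 * max 0 x) (at x)" using 1 by simp
    then show ?thesis
      by (rule has_field_derivative_transform_within_open[of _ _ _ "{..<0}"]) (use 1 in auto)
  next
    case 2
    have "((\<lambda>h::real. (max 0 (0 + h))\<^sup>2 / h) \<longlongrightarrow> 0) (at 0)"
    proof (rule Lim_null_comparison)
      show "\<forall>\<^sub>F h in at 0. norm ((max 0 (0 + h))\<^sup>2 / h) \<le> \<bar>h::real\<bar>"
        by (rule always_eventually) (auto simp: max_def power2_eq_square)
      show "((\<lambda>h::real. \<bar>h\<bar>) \<longlongrightarrow> 0) (at 0)" by (auto intro!: tendsto_eq_intros)
    qed
    then show ?thesis using 2 by (simp add: DERIV_def)
  next
    case 3
    have "((\<lambda>x. x\<^sup>2) has_real_derivative 2 * max 0 x) (at x)"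
      using 3 by (auto intro!: derivative_eq_intros)
    then show ?thesis
      by (rule has_field_derivative_transform_within_open[of _ _ _ "{0<..}"]) (use 3 in auto)
  qed
qed

text \<open>
  A continuously differentiable function supported in \<open>[a, b]\<close>; as \<open>c\<close> decreases to zero it tends to the
  indicator of \<open>(a, b)\<close>.
\<close>
definition bump :: "real \<Rightarrow> real \<Rightarrow> real \<Rightarrow> real \<Rightarrow> real" where
  "bump a b c x = (max 0 (x - a))\<^sup>2 * (max 0 (b - x))\<^sup>2 / (c + (max 0 (x - a))\<^sup>2 * (max 0 (b - x))\<^sup>2)"

lemma bump_bounds: "0 < c \<Longrightarrow> 0 \<le> bump a b c x" "0 < c \<Longrightarrow> bump a b c x \<le> 1"
  by (auto simp: bump_def divide_le_eq add_pos_nonneg intro!: divide_nonneg_nonneg)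

lemma bump_in_C1c:
  assumes ab: "0 < a" "b < 1" and c: "0 < c"
  shows "bump a b c \<in> C1c"
proof -
  define A where "A = (\<lambda>x. (max 0 (x - a))\<^sup>2 * (max 0 (b - x))\<^sup>2)"
  define A' where "A' = (\<lambda>x. 2 * max 0 (x - a) * (max 0 (b - x))\<^sup>2 - (max 0 (x - a))\<^sup>2 * (2 * max 0 (b - x)))"
  have Apos: "0 < c + A x" for x unfolding A_def using c by (intro add_pos_nonneg) auto
  have dA: "(A has_real_derivative A' x) (at x)" for x
  proof -
    have 1: "((\<lambda>x. (max 0 (x - a))\<^sup>2) has_real_derivative 2 * max 0 (x - a)) (at x)"
    proof -
      have "((\<lambda>x. x - a) has_real_derivative 1) (at x)" by (auto intro!: derivative_eq_intros)
      from DERIV_chain2[OF square_pos_part_has_derivative this] show ?thesis by simp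
    qed
    have 2: "((\<lambda>x. (max 0 (b - x))\<^sup>2) has_real_derivative - (2 * max 0 (b - x))) (at x)"
    proof -
      have "((\<lambda>x. b - x) has_real_derivative -1) (at x)" by (auto intro!: derivative_eq_intros)
      from DERIV_chain2[OF square_pos_part_has_derivative this] show ?thesis by simp
    qed
    show ?thesis unfolding A_def A'_def
      using DERIV_mult[OF 1 2] by (simp add: algebra_simps)
  qed
  have "(bump a b c has_real_derivative c * A' x / (c + A x)\<^sup>2) (at x)" for x
  proof -
    have eq: "bump a b c = (\<lambda>x. A x / (c + A x))" by (auto simp: bump_def A_def)
    have "((\<lambda>x. A x / (c + A x)) has_real_derivative (A' x * (c + A x) - A x * (0 + A' x)) / ((c + A x) * (c + A x))) (at x)"
      using Apos[of x] by (intro DERIV_divide dA DERIV_add DERIV_const) auto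
    then show ?thesis unfolding eq by (simp add: power2_eq_square algebra_simps)
  qed
  moreover have "continuous_on UNIV (\<lambda>x. c * A' x / (c + A x)\<^sup>2)"
  proof (intro continuous_intros)
    show "continuous_on UNIV A" "continuous_on UNIV A'"
      unfolding A_def A'_def by (intro continuous_intros)+
    show "\<forall>x\<in>UNIV. (c + A x)\<^sup>2 \<noteq> 0" using Apos by (metis less_irrefl power_eq_0_iff)
  qed
  moreover have "closure {x. bump a b c x \<noteq> 0} \<subseteq> {a..b}"
    by (rule closure_minimal) (auto simp: bump_def max_def split: if_splits)
  moreover from this have "compact (closure {x. bump a b c x \<noteq> 0})"
    by (meson bounded_closed_interval bounded_subset closed_closure compact_eq_bounded_closed)
  ultimately show ?thesis
    using ab unfolding C1c_def C1_differentiable_on_def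
    by (force simp: has_real_derivative_iff_has_vector_derivative)
qed

lemma bump_tendsto_indicator:
  assumes s: "s \<longlonglongrightarrow> 0" "\<And>n. 0 < s n"
  shows "(\<lambda>n. bump (a + s n) (b - s n) (s n) x) \<longlonglongrightarrow> indicator {a<..<b} x"
proof (cases "x \<in> {a<..<b}")
  case True
  have "(\<lambda>n. bump (a + s n) (b - s n) (s n) x) \<longlonglongrightarrow>
     (max 0 (x - (a + 0)))\<^sup>2 * (max 0 ((b - 0) - x))\<^sup>2 / (0 + (max 0 (x - (a + 0)))\<^sup>2 * (max 0 ((b - 0) - x))\<^sup>2)"
    unfolding bump_def by (intro tendsto_intros s) (use True in auto)
  then show ?thesis using True by simp
next
  case False
  have "bump (a + s n) (b - s n) (s n) x = 0" for n
  proof -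
    have "max 0 (x - (a + s n)) = 0 \<or> max 0 ((b - s n) - x) = 0"
      using False s(2)[of n] by (auto simp: max_def)
    then show ?thesis by (auto simp: bump_def)
  qed
  then show ?thesis using False by simp
qed

lemma measure_interval_from_C1c:
  assumes P: "finite_measure P" "sets P = sets (restrict_space borel {0<..<1::real})" and ab: "0 \<le> a" "b \<le> 1"
  shows "(\<lambda>n. LINT x|P. bump (a + 1 / real (n + 1)) (b - 1 / real (n + 1)) (1 / real (n + 1)) x)
    \<longlonglongrightarrow> measure P {a<..<b}"
proof -
  interpret finite_measure P by fact
  define s where "s = (\<lambda>n. 1 / real (n + 1))"
  have s: "s \<longlonglongrightarrow> 0" "\<And>n. 0 < s n"
    using LIMSEQ_ignore_initial_segment[OF lim_const_over_n[of 1], of 1] by (auto simp: s_def)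
  have "{a<..<b} = {0<..<1} \<inter> {a<..<b}" using ab by auto
  then have ms: "{a<..<b} \<in> sets P" unfolding P(2) sets_restrict_space by auto
  have "(\<lambda>n. LINT x|P. bump (a + s n) (b - s n) (s n) x) \<longlonglongrightarrow> (LINT x|P. indicator {a<..<b} x)"
  proof (rule integral_dominated_convergence[where w = "\<lambda>_. 1"])
    show "(\<lambda>x. indicator {a<..<b} x :: real) \<in> borel_measurable P" using ms by simp
    show "bump (a + s n) (b - s n) (s n) \<in> borel_measurable P" for n
    proof -
      have "bump (a + s n) (b - s n) (s n) \<in> borel_measurable (restrict_space borel {0<..<1})"
        unfolding bump_def by (intro measurable_restrict_space1) measurable
      then show ?thesis using measurable_cong_sets[OF P(2) refl] by blast
    qed
    show "AE x in P. (\<lambda>n. bump (a + s n) (b - s n) (s n) x) \<longlonglongrightarrow> indicator {a<..<b} x"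
      by (rule AE_I2) (rule bump_tendsto_indicator[OF s])
    show "AE x in P. norm (bump (a + s n) (b - s n) (s n) x) \<le> 1" for n
      by (rule AE_I2) (use bump_bounds[OF s(2)] in auto)
  qed simp
  then show ?thesis using ms by (simp add: s_def)
qed

text \<open>
  The bumps recover the measures of open intervals from the integrals of test functions, and these
  intervals form a generator of the Borel sets that is stable under intersections.
\<close>
lemma measure_difference_unique:
  fixes P N P' N' :: "real measure"
  assumes fin: "finite_measure P" "finite_measure N" "finite_measure P'" "finite_measure N'"
    and sets: "sets P = sets (restrict_space borel {0<..<1})" "sets N = sets (restrict_space borel {0<..<1})"
      "sets P' = sets (restrict_space borel {0<..<1})" "sets N' = sets (restrict_space borel {0<..<1})"
    and eq: "\<And>\<psi>. \<psi> \<in> C1c \<Longrightarrow> (LINT x|P. \<psi> x) - (LINT x|N. \<psi> x) = (LINT x|P'. \<psi> x) - (LINT x|N'. \<psi> x)"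
  shows "measure P A - measure N A = measure P' A - measure N' A"
proof -
  let ?I = "{0<..<1::real}"
  define d where "d = (\<lambda>A. measure P A - measure N A - (measure P' A - measure N' A))"
  have dI: "d {a<..<b} = 0" if ab: "0 \<le> a" "b \<le> 1" for a b
  proof -
    define k where "k = (\<lambda>n. bump (a + 1 / real (n + 1)) (b - 1 / real (n + 1)) (1 / real (n + 1)))"
    have k: "k n \<in> C1c" for n unfolding k_def
    proof (rule bump_in_C1c)
      have n: "0 < 1 / real (n + 1)" by simp
      show "0 < a + 1 / real (n + 1)" using ab(1) n by (rule add_nonneg_pos)
      show "b - 1 / real (n + 1) < 1" using ab(2) n by linarith
    qed simp
    have lim: "(\<lambda>n. LINT x|M. k n x) \<longlonglongrightarrow> measure M {a<..<b}"
      if "finite_measure M" "sets M = sets (restrict_space borel ?I)" for M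
      unfolding k_def by (rule measure_interval_from_C1c[OF that ab])
    have "(\<lambda>n. (LINT x|P. k n x) - (LINT x|N. k n x) - ((LINT x|P'. k n x) - (LINT x|N'. k n x))) \<longlonglongrightarrow> d {a<..<b}"
      unfolding d_def by (intro tendsto_diff lim fin sets)
    then show ?thesis unfolding eq[OF k] by (simp add: LIMSEQ_const_iff)
  qed
  have inter: "A \<inter> ?I \<in> sets (restrict_space borel ?I)" if "A \<in> sets borel" for A
    using that unfolding sets_restrict_space by auto
  have diff: "measure M (?I - A \<inter> ?I) = measure M ?I - measure M (A \<inter> ?I)"
    if "finite_measure M" "sets M = sets (restrict_space borel ?I)" "A \<in> sets borel" for M :: "real measure" and A
    using inter[of UNIV] inter[OF that(3)] that
    by (intro finite_measure.finite_measure_Diff) auto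
  have union_sums: "(\<lambda>i. measure M (A i \<inter> ?I)) sums measure M (\<Union>i. A i \<inter> ?I)"
    if "finite_measure M" "sets M = sets (restrict_space borel ?I)" "range A \<subseteq> sets borel" "disjoint_family A"
    for M :: "real measure" and A :: "nat \<Rightarrow> real set"
  proof (rule finite_measure.finite_measure_UNION[OF that(1)])
    show "range (\<lambda>i. A i \<inter> ?I) \<subseteq> sets M" using inter that(2,3) by auto
    show "disjoint_family (\<lambda>i. A i \<inter> ?I)" using that(4) unfolding disjoint_family_on_def by blast
  qed
  have borel: "d (A \<inter> ?I) = 0" if "A \<in> sets borel" for A
  proof -
    define G where "G = range (\<lambda>(a, b). {a<..<b::real})"
    have bG: "sets borel = sigma_sets UNIV G"
      unfolding borel_eq_box G_def box_real by (simp add: sets_measure_of)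
    have "Int_stable G"
    proof (rule Int_stableI)
      fix X Y assume "X \<in> G" "Y \<in> G"
      then obtain a b a' b' where "X = {a<..<b}" "Y = {a'<..<b'}" by (auto simp: G_def)
      then have "X \<inter> Y = {max a a'<..<min b b'}" by auto
      then show "X \<inter> Y \<in> G" by (auto simp: G_def)
    qed
    moreover have "G \<subseteq> Pow UNIV" by simp
    moreover have "A \<in> sigma_sets UNIV G" using that bG by simp
    ultimately show ?thesis
    proof (induction rule: sigma_sets_induct_disjoint)
      case (basic A)
      then obtain a b where "A = {a<..<b}" by (auto simp: G_def)
      then have "A \<inter> ?I = {max a 0<..<min b 1}" by auto
      then show ?case using dI[of "max a 0" "min b 1"] by simp
    next
      case empty
      then show ?case by (simp add: d_def)
    next
      case (compl A)
      then have A: "A \<in> sets borel" using bG by simp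
      have "(UNIV - A) \<inter> ?I = ?I - A \<inter> ?I" by auto
      then have "d ((UNIV - A) \<inter> ?I) = d ?I - d (A \<inter> ?I)"
        unfolding d_def by (simp add: diff[OF _ _ A] fin sets)
      then show ?case using compl dI[of 0 1] by simp
    next
      case (union A)
      then have A: "range A \<subseteq> sets borel" using bG by simp
      have "(\<Union>i. A i) \<inter> ?I = (\<Union>i. A i \<inter> ?I)" by auto
      then have "(\<lambda>i. d (A i \<inter> ?I)) sums d ((\<Union>i. A i) \<inter> ?I)"
        unfolding d_def by (simp only:) (intro sums_diff union_sums fin sets A union(1))
      then show ?case using union(3) by (simp add: sums_iff)
    qed
  qed
  show ?thesis
  proof (cases "A \<in> sets (restrict_space borel ?I)")
    case True
    then obtain B where "B \<in> sets borel" "A = ?I \<inter> B" unfolding sets_restrict_space by auto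
    then show ?thesis using borel[of B] by (simp add: d_def Int_commute)
  next
    case False
    then show ?thesis using sets by (simp add: measure_notin_sets)
  qed
qed

text \<open>
  Integration by parts shows that the difference of the Stieltjes measures is a distributional
  derivative, and \<open>measure_difference_unique\<close> shows that there is only one.
\<close>
lemma distr_deriv_eq:
  assumes u: "u absolutely_integrable_on {0..1}"
    and U: "BV_primitive (\<lambda>x. integral {0..x} u) 0 1 g1 g2"
  shows "distr_deriv u = (\<lambda>A. measure (stieltjes g1) A - measure (stieltjes g2) A)"
proof -
  have g: "mono g1" "mono g2" "\<And>x. continuous (at_right x) g1" "\<And>x. continuous (at_right x) g2"
    and int: "\<And>x y. 0 \<le> x \<Longrightarrow> x \<le> y \<Longrightarrow> y \<le> 1 \<Longrightarrow>
      ((\<lambda>t. g1 t - g2 t) has_integral (integral {0..y} u - integral {0..x} u)) {x..y}"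
    using U by (auto simp: BV_primitive_def)
  note toint = set_lebesgue_integral_eq_integral(1)
  note gabs = mono_absolutely_integrable[OF g(1)] mono_absolutely_integrable[OF g(2)]
  have parts: "(LINT x:{0<..<1}|lebesgue. u x * deriv \<psi> x)
      = - ((LINT x|stieltjes g1. \<psi> x) - (LINT x|stieltjes g2. \<psi> x))" if \<psi>: "\<psi> \<in> C1c" for \<psi>
  proof -
    have c: "continuous_on {0..1} (deriv \<psi>)" using C1c_deriv(2)[OF \<psi>] by (rule continuous_on_subset) simp
    have "integral {0..1} (\<lambda>t. (u t - (g1 t - g2 t)) * deriv \<psi> t) = 0"
    proof (rule integral_mult_continuous_zero[OF _ _ c])
      show "(\<lambda>t. u t - (g1 t - g2 t)) absolutely_integrable_on {0..1}"
        by (intro set_integral_diff(1) u gabs)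
      fix a b :: real assume ab: "0 \<le> a" "a \<le> b" "b \<le> 1"
      have ui: "u integrable_on {x..y}" if "0 \<le> x" "y \<le> 1" for x y
        using toint[OF u] by (rule integrable_on_subinterval) (use that in auto)
      have "integral {a..b} u = integral {0..b} u - integral {0..a} u"
        using Henstock_Kurzweil_Integration.integral_combine[of 0 a b u] ab ui[of 0 b] by simp
      then have "(u has_integral (integral {0..b} u - integral {0..a} u)) {a..b}"
        using ui[of a b] ab by (metis integrable_integral)
      from has_integral_diff[OF this int[OF ab]]
      show "integral {a..b} (\<lambda>t. u t - (g1 t - g2 t)) = 0" by (auto intro: integral_unique)
    qed
    moreover have "integral {0..1} (\<lambda>t. (u t - (g1 t - g2 t)) * deriv \<psi> t)
      = integral {0..1} (\<lambda>t. u t * deriv \<psi> t) - (integral {0..1} (\<lambda>t. g1 t * deriv \<psi> t) - integral {0..1} (\<lambda>t. g2 t * deriv \<psi> t))"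
    proof -
      note i = toint[OF C1c_mult_absolutely_integrable[OF \<psi>]]
      have "integral {0..1} (\<lambda>t. u t * deriv \<psi> t - (g1 t * deriv \<psi> t - g2 t * deriv \<psi> t))
        = integral {0..1} (\<lambda>t. u t * deriv \<psi> t) - integral {0..1} (\<lambda>t. g1 t * deriv \<psi> t - g2 t * deriv \<psi> t)"
        by (intro Henstock_Kurzweil_Integration.integral_diff integrable_diff i u gabs)
      also have "integral {0..1} (\<lambda>t. g1 t * deriv \<psi> t - g2 t * deriv \<psi> t)
        = integral {0..1} (\<lambda>t. g1 t * deriv \<psi> t) - integral {0..1} (\<lambda>t. g2 t * deriv \<psi> t)"
        by (intro Henstock_Kurzweil_Integration.integral_diff i gabs)
      finally show ?thesis by (simp add: algebra_simps)
    qed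
    ultimately show ?thesis
      using lebesgue_integral_unit[OF C1c_mult_absolutely_integrable[OF \<psi> u]]
        stieltjes_integration_by_parts[OF g(1,3) \<psi>] stieltjes_integration_by_parts[OF g(2,4) \<psi>] by simp
  qed
  note st = stieltjes_basic[OF g(1,3)] stieltjes_basic[OF g(2,4)]
  have ex: "is_distr_deriv u (\<lambda>A. measure (stieltjes g1) A - measure (stieltjes g2) A)"
    unfolding is_distr_deriv_def
    by (intro exI[of _ "stieltjes g1"] exI[of _ "stieltjes g2"]) (use st parts in auto)
  show ?thesis unfolding distr_deriv_def
  proof (rule the_equality[where P = "is_distr_deriv u", OF ex])
    fix \<mu> assume "is_distr_deriv u \<mu>"
    then obtain P N where PN: "finite_measure P" "finite_measure N"
      "sets P = sets (restrict_space borel {0<..<1})" "sets N = sets (restrict_space borel {0<..<1})"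
      and \<mu>: "\<And>A. \<mu> A = measure P A - measure N A"
      and i: "\<And>\<psi>. \<psi> \<in> C1c \<Longrightarrow> (LINT x:{0<..<1}|lebesgue. u x * deriv \<psi> x) = - ((LINT x|P. \<psi> x) - (LINT x|N. \<psi> x))"
      unfolding is_distr_deriv_def by blast
    show "\<mu> = (\<lambda>A. measure (stieltjes g1) A - measure (stieltjes g2) A)"
    proof
      fix A
      have "measure P A - measure N A = measure (stieltjes g1) A - measure (stieltjes g2) A"
        by (rule measure_difference_unique[OF PN(1,2) st(1,4) PN(3,4) st(2,5)])
           (use i parts in fastforce)
      then show "\<mu> A = measure (stieltjes g1) A - measure (stieltjes g2) A" using \<mu> by simp
    qed
  qed
qed

text \<open>
  The monotone functions of the Jordan decomposition have left limits and are right-continuous, and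
  averages over shrinking intervals inherit these limits. The jump of the representatives is the
  measure of the point \<open>x\<close>; the trace at \<open>0\<close> cancels.
\<close>
lemma rof_solution_one_sided_limits:
  assumes f: "f \<in> Linf" and \<alpha>: "0 < \<alpha>" and sol: "rof_solution \<alpha> f u" and x: "0 < x" "x < 1"
  shows "\<exists>l r. left_slope (\<lambda>x. integral {0..x} u) x l \<and> right_slope (\<lambda>x. integral {0..x} u) x r \<and>
    left_rep u x - right_rep u x = l - r"
proof -
  define U where "U = (\<lambda>x. integral {0..x} u)"
  obtain g1 g2 where G: "BV_primitive U 0 1 g1 g2"
    using taut_string_BV_primitive[OF rof_solution_taut_string[OF f \<alpha> sol] \<alpha>] unfolding U_def by blast
  have g: "mono g1" "mono g2" "\<And>x. continuous (at_right x) g1" "\<And>x. continuous (at_right x) g2"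
    and int: "\<And>x y. 0 \<le> x \<Longrightarrow> x \<le> y \<Longrightarrow> y \<le> 1 \<Longrightarrow> ((\<lambda>t. g1 t - g2 t) has_integral (U y - U x)) {x..y}"
    using G by (auto simp: BV_primitive_def)
  have u: "u absolutely_integrable_on {0..1}" using rof_solution_finite[OF f \<alpha> sol] by metis
  obtain L1 where L1: "(g1 \<longlongrightarrow> L1) (at_left x)" using mono_left_limit_exists[OF g(1)] by blast
  obtain L2 where L2: "(g2 \<longlongrightarrow> L2) (at_left x)" using mono_left_limit_exists[OF g(2)] by blast
  have "left_slope U x (L1 - L2)"
    by (rule left_slope_of_integral[OF x(1) _ tendsto_diff[OF L1 L2]]) (use int x in auto)
  moreover have "right_slope U x (g1 x - g2 x)"
  proof (rule right_slope_of_integral[OF x(2)])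
    show "((\<lambda>t. g1 t - g2 t) \<longlongrightarrow> g1 x - g2 x) (at_right x)"
      using g(3,4)[of x] by (intro tendsto_diff) (auto simp: continuous_within)
  qed (use int x in auto)
  moreover have "left_rep u x - right_rep u x = (L1 - L2) - (g1 x - g2 x)"
    unfolding left_rep_def right_rep_def distr_deriv_eq[OF u G[unfolded U_def]]
    using stieltjes_open[OF g(1,3) x L1] stieltjes_open[OF g(2,4) x L2]
      stieltjes_basic(3)[OF g(1,3) x] stieltjes_basic(3)[OF g(2,4) x] by simp
  ultimately show ?thesis unfolding U_def by blast
qed

lemma left_slope_unique: "left_slope U x l \<Longrightarrow> left_slope U x l' \<Longrightarrow> l = l'"
  unfolding left_slope_def by (rule tendsto_unique[rotated]) auto

lemma right_slope_unique: "right_slope U x r \<Longrightarrow> right_slope U x r' \<Longrightarrow> r = r'"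
  unfolding right_slope_def by (rule tendsto_unique[rotated]) auto

lemma jump_set_iff:
  assumes u: "u absolutely_integrable_on {0..1}" and x: "0 < x" "x < 1"
    and l: "left_slope (\<lambda>x. integral {0..x} u) x l" and r: "right_slope (\<lambda>x. integral {0..x} u) x r"
  shows "x \<in> jump_set u \<longleftrightarrow> l \<noteq> r"
proof -
  have "left_approx_lim u x l' \<longleftrightarrow> l' = l" for l'
    using left_slope_unique[OF _ l, of l'] l unfolding left_approx_lim_iff[OF u x] by blast
  moreover have "right_approx_lim u x r' \<longleftrightarrow> r' = r" for r'
    using right_slope_unique[OF _ r, of r'] r unfolding right_approx_lim_iff[OF u x] by blast
  ultimately show ?thesis using x by (simp add: jump_set_def)
qed

section \<open>Nesting of the jump sets\<close>
text \<open>
  Up to reflection of the tube the jump of \<open>U2\<close> is upward, and then the jump of \<open>U1\<close> contains it: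
  \<open>l1 \<le> l2 < r2 \<le> r1\<close>.
\<close>
lemma taut_string_jumps_nested:
  assumes taut: "taut_string \<alpha>1 F U1" "taut_string \<alpha>2 F U2" and le: "\<alpha>1 \<le> \<alpha>2" and x: "0 < x" "x < 1"
    and U1: "left_slope U1 x l1" "right_slope U1 x r1" and U2: "left_slope U2 x l2" "right_slope U2 x r2"
    and jump: "l2 \<noteq> r2"
  shows "l1 \<noteq> r1" "\<bar>l2 - r2\<bar> \<le> \<bar>l1 - r1\<bar>"
proof -
  have "l1 \<le> l2 \<and> l2 < r2 \<and> r2 \<le> r1 \<or> l2 \<le> l1 \<and> r2 < l2 \<and> r1 \<le> r2"
  proof (cases "l2 < r2")
    case True
    then show ?thesis using taut_string_jump_comparison[OF taut le x U2 True U1] by simp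
  next
    case False
    then have "- l2 < - r2" using jump by simp
    from taut_string_jump_comparison[OF taut_string_uminus[OF taut(1)] taut_string_uminus[OF taut(2)] le x
        slope_uminus(1)[OF U2(1)] slope_uminus(2)[OF U2(2)] this slope_uminus(1)[OF U1(1)] slope_uminus(2)[OF U1(2)]]
    show ?thesis using False jump by auto
  qed
  then show "l1 \<noteq> r1" "\<bar>l2 - r2\<bar> \<le> \<bar>l1 - r1\<bar>" by auto
qed

lemma taut_string_data_jumps:
  assumes taut: "taut_string \<alpha> F U" and x: "0 < x" "x < 1"
    and U: "left_slope U x l" "right_slope U x r" and F: "left_slope F x l'" "right_slope F x r'"
    and jump: "l \<noteq> r"
  shows "l' \<noteq> r'"
proof (cases "l < r")
  case True
  then show ?thesis using taut_string_data_jump[OF taut x U True F] by simp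
next
  case False
  then have "- l < - r" using jump by simp
  from taut_string_data_jump[OF taut_string_uminus[OF taut] x
      slope_uminus(1)[OF U(1)] slope_uminus(2)[OF U(2)] this slope_uminus(1)[OF F(1)] slope_uminus(2)[OF F(2)]]
  show ?thesis using False jump by auto
qed

theorem theorem1p2:
  fixes f u1 u2 :: "real \<Rightarrow> real" and \<alpha>1 \<alpha>2 :: real
  assumes "f \<in> Linf"
    and "\<forall>x\<in>{0<..<1}. (\<exists>l. left_approx_lim f x l) \<and> (\<exists>r. right_approx_lim f x r)"
    and "0 < \<alpha>1" and "0 < \<alpha>2"
    and "rof_solution \<alpha>1 f u1" and "rof_solution \<alpha>2 f u2"
    and "\<alpha>1 \<le> \<alpha>2"
  shows "jump_set u2 \<subseteq> jump_set u1 \<and> jump_set u1 \<subseteq> jump_set f \<and>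
         (\<forall>x\<in>jump_set u2. \<bar>left_rep u1 x - right_rep u1 x\<bar> \<ge> \<bar>left_rep u2 x - right_rep u2 x\<bar>)"
proof -
  note taut = rof_solution_taut_string[OF assms(1,3,5)] rof_solution_taut_string[OF assms(1,4,6)]
  have u1: "u1 absolutely_integrable_on {0..1}" using rof_solution_finite[OF assms(1,3,5)] by metis
  have u2: "u2 absolutely_integrable_on {0..1}" using rof_solution_finite[OF assms(1,4,6)] by metis
  note f = Linf_square_integrable(1)[OF assms(1)]
  have 1: "x \<in> jump_set u1 \<and> \<bar>left_rep u2 x - right_rep u2 x\<bar> \<le> \<bar>left_rep u1 x - right_rep u1 x\<bar>"
    if jump: "x \<in> jump_set u2" for x
  proof -
    have x: "0 < x" "x < 1" using jump by (auto simp: jump_set_def)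
    obtain l1 r1 where s1: "left_slope (\<lambda>x. integral {0..x} u1) x l1" "right_slope (\<lambda>x. integral {0..x} u1) x r1"
      "left_rep u1 x - right_rep u1 x = l1 - r1"
      using rof_solution_one_sided_limits[OF assms(1,3,5) x] by blast
    obtain l2 r2 where s2: "left_slope (\<lambda>x. integral {0..x} u2) x l2" "right_slope (\<lambda>x. integral {0..x} u2) x r2"
      "left_rep u2 x - right_rep u2 x = l2 - r2"
      using rof_solution_one_sided_limits[OF assms(1,4,6) x] by blast
    have "l2 \<noteq> r2" using jump jump_set_iff[OF u2 x s2(1,2)] by simp
    from taut_string_jumps_nested[OF taut assms(7) x s1(1,2) s2(1,2) this]
    show ?thesis using jump_set_iff[OF u1 x s1(1,2)] s1(3) s2(3) by simp
  qed
  have 2: "x \<in> jump_set f" if jump: "x \<in> jump_set u1" for x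
  proof -
    have x: "0 < x" "x < 1" using jump by (auto simp: jump_set_def)
    obtain l1 r1 where s1: "left_slope (\<lambda>x. integral {0..x} u1) x l1" "right_slope (\<lambda>x. integral {0..x} u1) x r1"
      using rof_solution_one_sided_limits[OF assms(1,3,5) x] by blast
    obtain l r where F: "left_slope (\<lambda>x. integral {0..x} f) x l" "right_slope (\<lambda>x. integral {0..x} f) x r"
      using bspec[OF assms(2), of x] x
      unfolding left_approx_lim_iff[OF f x] right_approx_lim_iff[OF f x] by auto
    have "l1 \<noteq> r1" using jump jump_set_iff[OF u1 x s1] by simp
    from taut_string_data_jumps[OF taut(1) x s1 F this]
    show ?thesis using jump_set_iff[OF f x F] by simp
  qed
  show ?thesis using 1 2 by blast
qed

end
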